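(* Let $g$ and $k$ be integers with $g \ge 3$ and $k \ge 2$, let $a \ge -1$ be a real number, and let $G$ be a simple graph of order $n$ with minimum degree $\delta \geq k \geq 2$ and girth $g$. Let $n_1^* = n_1^*(\delta,g)$. Each of the following holds. (i) If $\displaystyle \lambda_{2}(G, a)\leq (a+1)\delta-\frac{(k-1)n}{n_{1}^{*}(n-n_{1}^{*})}$, then $\kappa'(G)\geq k$. (ii) If $\displaystyle \lambda_{2}(G, a)<(a+1)\delta-\frac{2(k-1)}{n_{1}^{*}}$, then $\kappa'(G)\geq k$.
   Context: All graphs are finite and simple. $\kappa'(G)$ denotes the edge-connectivity of $G$. For a graph $G$ with adjacency matrix $A$ and diagonal degree matrix $D$, and a real number $a \ge -1$, $\lambda_i(G,a)$ denotes the $i$th largest eigenvalue (with multiplicity) of $aD+A$. The girth of $G$ is the length of a shortest cycle of $G$ ($\infty$ if $G$ is acyclic). For integers $\delta>0$ and $g\ge 3$, put $t=\lfloor \frac{g-1}{2}\rfloor$ and $$n_1^*=n_1^*(\delta,g)=\begin{cases}1+\delta+\sum_{i=2}^{t}(\delta-1)^{i}, & \text{if } g=2t+1,\\ 2+2(\delta-1)^{t}+\sum_{i=1}^{t-1}(\delta-1)^{i}, & \text{if } g=2t+2,\end{cases}$$ where empty sums are $0$. *)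

theory Defs
  imports
    "HOL-Library.Extended_Nat"
    "HOL-Library.Multiset"
    "Jordan_Normal_Form.Char_Poly"
begin

definition simple_graph :: "'a set \<Rightarrow> 'a set set \<Rightarrow> bool" where
  "simple_graph V E \<longleftrightarrow> finite V \<and> (\<forall>e\<in>E. e \<subseteq> V \<and> card e = 2)"

definition vdegree :: "'a set set \<Rightarrow> 'a \<Rightarrow> nat" where
  "vdegree E v = card {e \<in> E. v \<in> e}"

definition min_degree :: "'a set \<Rightarrow> 'a set set \<Rightarrow> nat" where
  "min_degree V E = Min (vdegree E ` V)"

definition graph_connected :: "'a set \<Rightarrow> 'a set set \<Rightarrow> bool" where
  "graph_connected V E \<longleftrightarrow> (\<forall>u\<in>V. \<forall>v\<in>V. (u, v) \<in> {(x, y). {x, y} \<in> E}\<^sup>*)"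

text \<open>
  The minimum number of edges whose removal disconnects the graph. A graph with at most one vertex
  cannot be disconnected; its edge-connectivity is 0 by convention.
\<close>

definition edge_connectivity :: "'a set \<Rightarrow> 'a set set \<Rightarrow> nat" where
  "edge_connectivity V E =
     (if card V \<le> 1 then 0
      else Min {card F | F. F \<subseteq> E \<and> \<not> graph_connected V (E - F)})"

definition is_cycle :: "'a set set \<Rightarrow> 'a list \<Rightarrow> bool" where
  "is_cycle E c \<longleftrightarrow> length c \<ge> 3 \<and> distinct c \<and>
     (\<forall>i < length c. {c ! i, c ! (Suc i mod length c)} \<in> E)"

text \<open>For an acyclic graph this is the infimum of the empty set, which is \<open>\<infinity>\<close>.\<close>

definition girth :: "'a set set \<Rightarrow> enat" where
  "girth E = Inf {enat (length c) | c. is_cycle E c}"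

text \<open>
  Matrices are indexed by natural numbers, so the vertices are enumerated in an arbitrary fixed
  order. Another order conjugates the matrices below by a permutation matrix and leaves the
  characteristic polynomial unchanged.
\<close>

definition vertex_list :: "'a set \<Rightarrow> 'a list" where
  "vertex_list V = (SOME vs. distinct vs \<and> set vs = V)"

lemma vertex_list:
  assumes "finite V"
  shows "distinct (vertex_list V)" "set (vertex_list V) = V"
proof -
  have "distinct (vertex_list V) \<and> set (vertex_list V) = V"
    unfolding vertex_list_def by (rule someI_ex) (use finite_distinct_list[OF assms] in blast)
  then show "distinct (vertex_list V)" "set (vertex_list V) = V" by auto
qed

definition adjacency_matrix :: "'a set \<Rightarrow> 'a set set \<Rightarrow> real mat" where
  "adjacency_matrix V E = mat (card V) (card V)
     (\<lambda>(i, j). if {vertex_list V ! i, vertex_list V ! j} \<in> E then 1 else 0)"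

definition degree_matrix :: "'a set \<Rightarrow> 'a set set \<Rightarrow> real mat" where
  "degree_matrix V E = mat (card V) (card V)
     (\<lambda>(i, j). if i = j then real (vdegree E (vertex_list V ! i)) else 0)"

text \<open>
  The \<open>i\<close>-th largest eigenvalue, for \<open>1 \<le> i \<le> dim_row M\<close>. It is meant for matrices whose
  characteristic polynomial splits over the reals, such as real symmetric ones: \<open>proots\<close> is the
  multiset of the real roots.
\<close>

definition nth_largest_eigenvalue :: "nat \<Rightarrow> real mat \<Rightarrow> real" where
  "nth_largest_eigenvalue i M = rev (sorted_list_of_multiset (proots (char_poly M))) ! (i - 1)"

definition graph_eigenvalue :: "nat \<Rightarrow> 'a set \<Rightarrow> 'a set set \<Rightarrow> real \<Rightarrow> real" where
  "graph_eigenvalue i V E a =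
     nth_largest_eigenvalue i (a \<cdot>\<^sub>m degree_matrix V E + adjacency_matrix V E)"

text \<open>
  Meant for \<open>\<delta> > 0\<close> and \<open>g \<ge> 3\<close>, where no subtraction truncates and \<open>g\<close> is either
  \<open>2 * t + 1\<close> or \<open>2 * t + 2\<close>.
\<close>

definition n1_star :: "nat \<Rightarrow> nat \<Rightarrow> nat" where
  "n1_star \<delta> g = (let t = (g - 1) div 2 in
     if g = 2 * t + 1 then 1 + \<delta> + (\<Sum>i=2..t. (\<delta> - 1) ^ i)
     else 2 + 2 * (\<delta> - 1) ^ t + (\<Sum>i=1..t-1. (\<delta> - 1) ^ i))"

end

theory Submission
  imports Defs "HOL-Computational_Algebra.Fundamental_Theorem_Algebra"
begin

text \<open>
  If fewer than \<open>k\<close> edges disconnect the graph, they contain all \<open>m \<le> k - 1 < \<delta>\<close> edges between some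
  vertex set \<open>S\<close> and its complement \<open>T\<close>. Applying Courant-Fischer to the plane of functions that are
  constant on \<open>S\<close> and on \<open>T\<close> gives \<open>\<lambda>\<^sub>2 \<ge> (a + 1) * \<delta> - m * (1 / card S + 1 / card T)\<close>.

  Both sides have at least \<open>n1_star \<delta> g\<close> vertices. Indeed \<open>S\<close> has a vertex \<open>x\<close> incident to no cut
  edge, and below the girth different non-backtracking walks from \<open>x\<close> end in different vertices, so one
  can count walks inside \<open>S\<close>: every level is \<open>\<delta> - 1\<close> times the previous one, except for the at most
  \<open>\<delta> - 1\<close> cut edges. For \<open>g = 2 * t + 2\<close> some neighbour \<open>y\<close> of \<open>x\<close> has no cut edge in its branch up to
  depth \<open>t\<close>, since there are at least \<open>\<delta>\<close> branches; the walks of length \<open>t + 1\<close> through \<open>y\<close> provide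
  the additional \<open>(\<delta> - 1) ^ t\<close> vertices.
\<close>

section \<open>The second eigenvalue of a real symmetric matrix\<close>

lemma scalar_prod_mult_mat_vec_symmetric:
  fixes A :: "'a::comm_semiring_0 mat"
  assumes A: "A \<in> carrier_mat n n" "A\<^sup>T = A" and v: "v \<in> carrier_vec n" "w \<in> carrier_vec n"
  shows "v \<bullet> (A *\<^sub>v w) = w \<bullet> (A *\<^sub>v v)"
proof -
  have "v \<bullet> (A *\<^sub>v w) = (A\<^sup>T *\<^sub>v v) \<bullet> w"
    using transpose_vec_mult_scalar[OF A(1) v(2,1)] by simp
  also have "\<dots> = w \<bullet> (A *\<^sub>v v)"
    using A v by (simp add: comm_scalar_prod[of _ n])
  finally show ?thesis .
qed

lemma real_scalar_prod_self:
  fixes v :: "real vec"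
  shows "v \<bullet> v \<ge> 0" "v \<in> carrier_vec n \<Longrightarrow> v \<bullet> v = 0 \<longleftrightarrow> v = 0\<^sub>v n"
proof -
  have *: "v \<bullet> v = (\<Sum>i<dim_vec v. (v $ i)\<^sup>2)"
    by (simp add: scalar_prod_def power2_eq_square atLeast0LessThan)
  show "v \<bullet> v \<ge> 0" unfolding * by (simp add: sum_nonneg)
  show "v \<bullet> v = 0 \<longleftrightarrow> v = 0\<^sub>v n" if "v \<in> carrier_vec n"
    using that unfolding * by (auto simp: sum_nonneg_eq_0_iff)
qed

text \<open>The fundamental theorem of algebra gives a complex eigenvector
  \<open>u = p + i q\<close> with eigenvalue \<open>z\<close>. Computing
  \<open>q \<bullet> (A *\<^sub>v p)\<close> in two ways by symmetry yields
  \<open>Im z * (p \<bullet> p + q \<bullet> q) = 0\<close>, so \<open>z\<close> is real, and a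
  nonzero one among \<open>p\<close> and \<open>q\<close> can be normalized.\<close>

lemma real_symmetric_eigenvector:
  fixes A :: "real mat"
  assumes A: "A \<in> carrier_mat n n" "A\<^sup>T = A" and "n > 0"
  obtains v e where "v \<in> carrier_vec n" "v \<bullet> v = 1" "A *\<^sub>v v = e \<cdot>\<^sub>v v"
proof -
  let ?C = "map_mat complex_of_real A"
  have C: "?C \<in> carrier_mat n n" using A by simp
  have "degree (char_poly ?C) = n" using degree_monic_char_poly[OF C] by simp
  then have "\<not> constant (poly (char_poly ?C))" using \<open>n > 0\<close> by (simp add: constant_degree)
  then obtain z where "poly (char_poly ?C) z = 0" using fundamental_theorem_of_algebra by blast
  then have "eigenvalue ?C z" using eigenvalue_root_char_poly[OF C] by simp
  then obtain u where u: "u \<in> carrier_vec n" "u \<noteq> 0\<^sub>v n" "?C *\<^sub>v u = z \<cdot>\<^sub>v u"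
    using C unfolding eigenvalue_def eigenvector_def by auto
  define p q where "p = map_vec Re u" and "q = map_vec Im u"
  have pq: "p \<in> carrier_vec n" "q \<in> carrier_vec n" using u by (auto simp: p_def q_def)
  have comp: "(\<Sum>j<n. of_real (A $$ (i, j)) * u $ j) = z * u $ i" if "i < n" for i
    using arg_cong[OF u(3), of "\<lambda>w. w $ i"] that A u(1)
    by (simp add: scalar_prod_def atLeast0LessThan)
  have Ap: "A *\<^sub>v p = Re z \<cdot>\<^sub>v p - Im z \<cdot>\<^sub>v q"
  proof (rule eq_vecI)
    fix i assume "i < dim_vec (Re z \<cdot>\<^sub>v p - Im z \<cdot>\<^sub>v q)"
    then have i: "i < n" using pq by simp
    show "(A *\<^sub>v p) $ i = (Re z \<cdot>\<^sub>v p - Im z \<cdot>\<^sub>v q) $ i"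
      using arg_cong[OF comp[OF i], of Re] i A u(1)
      by (simp add: p_def q_def scalar_prod_def atLeast0LessThan)
  qed (use A pq in simp)
  have Aq: "A *\<^sub>v q = Re z \<cdot>\<^sub>v q + Im z \<cdot>\<^sub>v p"
  proof (rule eq_vecI)
    fix i assume "i < dim_vec (Re z \<cdot>\<^sub>v q + Im z \<cdot>\<^sub>v p)"
    then have i: "i < n" using pq by simp
    show "(A *\<^sub>v q) $ i = (Re z \<cdot>\<^sub>v q + Im z \<cdot>\<^sub>v p) $ i"
      using arg_cong[OF comp[OF i], of Im] i A u(1)
      by (simp add: p_def q_def scalar_prod_def atLeast0LessThan)
  qed (use A pq in simp)
  have nz: "p \<bullet> p + q \<bullet> q \<noteq> 0"
  proof
    assume "p \<bullet> p + q \<bullet> q = 0"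
    then have "p \<bullet> p = 0" "q \<bullet> q = 0"
      using real_scalar_prod_self(1)[of p] real_scalar_prod_self(1)[of q] by linarith+
    then have "p = 0\<^sub>v n" "q = 0\<^sub>v n" using real_scalar_prod_self(2) pq by auto
    then have "u $ i = 0" if "i < n" for i
      using that u(1) arg_cong[of p "0\<^sub>v n" "\<lambda>w. w $ i"] arg_cong[of q "0\<^sub>v n" "\<lambda>w. w $ i"]
      unfolding p_def q_def complex_eq_iff by (metis carrier_vecD index_map_vec(1) index_zero_vec(1) zero_complex.sel)
    then show False using u(1,2) by (auto intro!: eq_vecI)
  qed
  have "q \<bullet> (A *\<^sub>v p) = p \<bullet> (A *\<^sub>v q)"
    by (rule scalar_prod_mult_mat_vec_symmetric[OF A pq(2,1)])
  then have "Im z * (p \<bullet> p + q \<bullet> q) = 0"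
    using pq comm_scalar_prod[OF pq]
    by (simp add: Ap Aq scalar_prod_minus_distrib[of _ n] scalar_prod_add_distrib[of _ n] algebra_simps)
  with nz have "Im z = 0" by simp
  then have "A *\<^sub>v p = Re z \<cdot>\<^sub>v p" "A *\<^sub>v q = Re z \<cdot>\<^sub>v q"
    using pq Ap Aq by auto
  with nz pq obtain w where w: "w \<in> carrier_vec n" "w \<bullet> w \<noteq> 0" "A *\<^sub>v w = Re z \<cdot>\<^sub>v w"
    by (metis add.right_neutral)
  define v where "v = (1 / sqrt (w \<bullet> w)) \<cdot>\<^sub>v w"
  have "v \<bullet> v = 1"
    using w real_scalar_prod_self(1)[of w] by (simp add: v_def field_simps)
  moreover have "A *\<^sub>v v = Re z \<cdot>\<^sub>v v"
    using w A by (simp add: v_def mult_mat_vec[of _ n n] smult_smult_assoc mult.commute)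
  ultimately show ?thesis using that[of v] w by (simp add: v_def)
qed

text \<open>\<open>W\<close> is the Householder reflection in the hyperplane orthogonal to
  \<open>v - unit_vec n 0\<close>. Being symmetric and its own inverse, it changes the basis in the
  deflation step below without a separate inverse.\<close>

lemma reflection_onto_unit_vec:
  fixes v :: "real vec"
  assumes v: "v \<in> carrier_vec n" "v \<bullet> v = 1" and "n > 0"
  obtains W where "W \<in> carrier_mat n n" "W\<^sup>T = W" "W * W = 1\<^sub>m n" "W *\<^sub>v unit_vec n 0 = v"
proof -
  define u where "u = v - unit_vec n 0"
  \<comment> \<open>If \<open>v\<close> is the first unit vector already, then
    \<open>u \<bullet> u = 0\<close>, division by zero makes \<open>c = 0\<close>, and
    \<open>W\<close> is the identity. The equation \<open>cc\<close> covers this case too.\<close>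
  define c where "c = 2 / (u \<bullet> u)"
  define W where "W = mat n n (\<lambda>(i, j). (if i = j then 1 else 0) - c * u $ i * u $ j)"
  have u: "u \<in> carrier_vec n" using v by (simp add: u_def)
  have W: "W \<in> carrier_mat n n" by (simp add: W_def)
  have uu: "(\<Sum>k<n. u $ k * u $ k) = u \<bullet> u" using u by (simp add: scalar_prod_def atLeast0LessThan)
  have cc: "c * c * (u \<bullet> u) = 2 * c" by (simp add: c_def)
  have uv: "u \<bullet> u = 2 - 2 * v $ 0"
    using v \<open>n > 0\<close> by (simp add: u_def minus_scalar_prod_distrib[of _ n] scalar_prod_minus_distrib[of _ n])
  have "W\<^sup>T = W" by (rule eq_matI) (auto simp: W_def)
  moreover have "W * W = 1\<^sub>m n"
  proof (rule eq_matI)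
    fix i j assume "i < dim_row (1\<^sub>m n)" "j < dim_col (1\<^sub>m n)"
    then have ij: "i < n" "j < n" by auto
    have "(W * W) $$ (i, j) = (\<Sum>k<n. W $$ (i, k) * W $$ (k, j))"
      using W ij by (simp add: scalar_prod_def atLeast0LessThan)
    also have "\<dots> = (\<Sum>k<n. (if k = i then (if i = j then 1 else 0) - c * u $ i * u $ j else 0)
         - (if k = j then c * u $ i * u $ j else 0) + c * c * u $ i * u $ j * (u $ k * u $ k))"
      using ij by (intro sum.cong) (auto simp: W_def algebra_simps)
    also have "\<dots> = (if i = j then 1 else 0) - 2 * c * u $ i * u $ j + c * c * u $ i * u $ j * (u \<bullet> u)"
      using ij by (simp add: sum.distrib sum_subtractf sum_distrib_left[symmetric] uu)
    also have "\<dots> = (if i = j then 1 else 0) - 2 * c * u $ i * u $ j + (c * c * (u \<bullet> u)) * u $ i * u $ j"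
      by (simp add: algebra_simps)
    finally show "(W * W) $$ (i, j) = 1\<^sub>m n $$ (i, j)" using ij by (simp add: cc)
  qed (use W in auto)
  moreover have "W *\<^sub>v unit_vec n 0 = v"
  proof (rule eq_vecI)
    fix i assume "i < dim_vec v"
    then have i: "i < n" using v by simp
    have 1: "(W *\<^sub>v unit_vec n 0) $ i = (if i = 0 then 1 else 0) - c * u $ i * u $ 0"
      using i W \<open>n > 0\<close> by (simp add: W_def)
    have 2: "u $ i = v $ i - (if i = 0 then 1 else 0)" "u $ 0 = v $ 0 - 1"
      using i v \<open>n > 0\<close> by (simp_all add: u_def unit_vec_def)
    show "(W *\<^sub>v unit_vec n 0) $ i = v $ i"
    proof (cases "u \<bullet> u = 0")
      case True
      then have "u = 0\<^sub>v n" using real_scalar_prod_self(2)[OF u] by simp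
      then have "u $ i = 0" using i by simp
      then show ?thesis using 1 2 by simp
    next
      case False
      then have "c * u $ 0 = -1" using uv 2(2) by (simp add: c_def field_simps)
      then have "c * u $ i * u $ 0 = - u $ i" by (metis mult.assoc mult.commute mult_minus1_right)
      then show ?thesis using 1 2 by simp
    qed
  qed (use W v in auto)
  ultimately show ?thesis using that W by blast
qed

text \<open>Deflation: after conjugation by a reflection that moves an eigenvector to the first unit
  vector, the first column of the matrix is a multiple of that unit vector. By symmetry so is the
  first row, and the induction hypothesis applies to the remaining block \<open>C\<close>.\<close>

lemma real_symmetric_orthogonally_diagonalizable:
  fixes A :: "real mat"
  assumes "A \<in> carrier_mat n n" "A\<^sup>T = A"
  shows "\<exists>P d. P \<in> carrier_mat n n \<and> P\<^sup>T * P = 1\<^sub>m n \<and> A = P * mat_diag n d * P\<^sup>T"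
  using assms
proof (induction n arbitrary: A)
  case 0
  show ?case by (rule exI[of _ "1\<^sub>m 0"], rule exI) (use 0 in auto)
next
  case (Suc n A)
  let ?N = "Suc n"
  note A = Suc.prems
  obtain v e where v: "v \<in> carrier_vec ?N" "v \<bullet> v = 1" "A *\<^sub>v v = e \<cdot>\<^sub>v v"
    using real_symmetric_eigenvector[OF A] by blast
  obtain W where W: "W \<in> carrier_mat ?N ?N" "W\<^sup>T = W" "W * W = 1\<^sub>m ?N" "W *\<^sub>v unit_vec ?N 0 = v"
    using reflection_onto_unit_vec[OF v(1,2)] by blast
  define B where "B = W * A * W"
  have B: "B \<in> carrier_mat ?N ?N" using A W by (simp add: B_def)
  have BT: "B\<^sup>T = B"
    using A W by (simp add: B_def transpose_mult[of _ ?N ?N _ ?N] assoc_mult_mat[of _ ?N ?N _ ?N _ ?N])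
  have AB: "A = W * B * W"
  proof -
    have "W * B * W = (W * W) * A * (W * W)"
      using A(1) W(1) by (simp add: B_def assoc_mult_mat[of _ ?N ?N _ ?N _ ?N])
    then show ?thesis using A(1) W(3) by simp
  qed
  have "B *\<^sub>v unit_vec ?N 0 = W *\<^sub>v (A *\<^sub>v v)"
    using A W by (simp add: B_def assoc_mult_mat_vec[of _ ?N ?N _ ?N])
  also have "\<dots> = e \<cdot>\<^sub>v ((W * W) *\<^sub>v unit_vec ?N 0)"
    using v W(1,4) by (simp add: mult_mat_vec[of _ ?N ?N] assoc_mult_mat_vec[of _ ?N ?N _ ?N])
  finally have Be: "B *\<^sub>v unit_vec ?N 0 = e \<cdot>\<^sub>v unit_vec ?N 0" using W by simp
  have col: "B $$ (i, 0) = (if i = 0 then e else 0)" if "i < ?N" for i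
    using arg_cong[OF Be, of "\<lambda>w. w $ i"] that B by auto
  have row: "B $$ (0, i) = (if i = 0 then e else 0)" if "i < ?N" for i
    using col[OF that] that B arg_cong[OF BT, of "\<lambda>M. M $$ (i, 0)"] by simp
  define C where "C = mat n n (\<lambda>(i, j). B $$ (Suc i, Suc j))"
  have C: "C \<in> carrier_mat n n" by (simp add: C_def)
  have "C\<^sup>T = C"
  proof (rule eq_matI)
    fix i j assume "i < dim_row C" "j < dim_col C"
    then show "C\<^sup>T $$ (i, j) = C $$ (i, j)"
      using B arg_cong[OF BT, of "\<lambda>M. M $$ (Suc i, Suc j)"] by (simp add: C_def)
  qed (simp_all add: C_def)
  with Suc.IH[OF C] obtain P d where P: "P \<in> carrier_mat n n" "P\<^sup>T * P = 1\<^sub>m n" "C = P * mat_diag n d * P\<^sup>T"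
    by blast
  define Q where "Q = four_block_mat (1\<^sub>m 1) (0\<^sub>m 1 n) (0\<^sub>m n 1) P"
  define f where "f = (\<lambda>i. case i of 0 \<Rightarrow> e | Suc j \<Rightarrow> d j)"
  have Q: "Q \<in> carrier_mat ?N ?N" using four_block_carrier_mat[OF one_carrier_mat[of 1] P(1)] by (simp add: Q_def)
  have QT: "Q\<^sup>T = four_block_mat (1\<^sub>m 1) (0\<^sub>m 1 n) (0\<^sub>m n 1) P\<^sup>T"
    unfolding Q_def using P by (subst transpose_four_block_mat[of _ 1 1 _ n _ n]) auto
  have D: "mat_diag ?N f = four_block_mat (e \<cdot>\<^sub>m 1\<^sub>m 1) (0\<^sub>m 1 n) (0\<^sub>m n 1) (mat_diag n d)"
    by (rule eq_matI) (auto simp: mat_diag_def f_def split: nat.splits)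
  have "Q\<^sup>T * Q = four_block_mat (1\<^sub>m 1) (0\<^sub>m 1 n) (0\<^sub>m n 1) (1\<^sub>m n)"
    unfolding QT unfolding Q_def using P by (subst mult_four_block_mat[of _ 1 1 _ n _ n _ _ 1 _ n]) auto
  also have "\<dots> = 1\<^sub>m ?N" by (rule eq_matI) auto
  finally have QQ: "Q\<^sup>T * Q = 1\<^sub>m ?N" .
  have "Q * mat_diag ?N f = four_block_mat (e \<cdot>\<^sub>m 1\<^sub>m 1) (0\<^sub>m 1 n) (0\<^sub>m n 1) (P * mat_diag n d)"
    unfolding D unfolding Q_def using P
    by (subst mult_four_block_mat[of _ 1 1 _ n _ n _ _ 1 _ n])
      (auto simp: left_mult_zero_mat[OF mat_diag_dim])
  then have "Q * mat_diag ?N f * Q\<^sup>T = four_block_mat (e \<cdot>\<^sub>m 1\<^sub>m 1) (0\<^sub>m 1 n) (0\<^sub>m n 1) (P * mat_diag n d)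
      * four_block_mat (1\<^sub>m 1) (0\<^sub>m 1 n) (0\<^sub>m n 1) P\<^sup>T"
    by (simp only: QT)
  also have "\<dots> = four_block_mat (e \<cdot>\<^sub>m 1\<^sub>m 1) (0\<^sub>m 1 n) (0\<^sub>m n 1) (P * mat_diag n d * P\<^sup>T)"
    using P(1) mult_carrier_mat[OF P(1) mat_diag_dim]
    by (subst mult_four_block_mat[of _ 1 1 _ n _ n _ _ 1 _ n]) (use C P(3) right_mult_zero_mat[OF mult_carrier_mat[OF P(1) mat_diag_dim]] in \<open>auto simp del: mult_carrier_mat\<close>)
  also have "\<dots> = B"
    unfolding P(3)[symmetric] by (rule eq_matI) (use B row col in \<open>auto simp: C_def\<close>)
  finally have BQ: "B = Q * mat_diag ?N f * Q\<^sup>T" ..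
  show ?case
  proof (intro exI conjI)
    show "W * Q \<in> carrier_mat ?N ?N" using W Q by simp
    have "(W * Q)\<^sup>T * (W * Q) = Q\<^sup>T * ((W * W) * Q)"
      using W(1,2) Q by (simp add: transpose_mult[of _ ?N ?N _ ?N] assoc_mult_mat[of _ ?N ?N _ ?N _ ?N])
    then show "(W * Q)\<^sup>T * (W * Q) = 1\<^sub>m ?N" using W(3) Q QQ by simp
    have "W * (Q * D * R) * W = W * Q * D * (R * W)"
      if "D \<in> carrier_mat ?N ?N" "R \<in> carrier_mat ?N ?N" for D R
      using that W(1) Q by (simp add: assoc_mult_mat[of _ ?N ?N _ ?N _ ?N])
    from this[of "mat_diag ?N f" "Q\<^sup>T"] show "A = W * Q * mat_diag ?N f * (W * Q)\<^sup>T"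
      unfolding AB BQ using W(1,2) Q by (simp add: transpose_mult[of _ ?N ?N _ ?N])
  qed
qed

section \<open>From the sorted roots of the characteristic polynomial to a bound by the second
  eigenvalue\<close>

lemma rev_sorted_list_of_multiset_nth_1:
  fixes A :: "'a::linorder multiset"
  assumes "size A \<ge> 2"
  obtains a where "a \<in># A" "\<And>b. b \<in># A - {#a#} \<Longrightarrow> b \<le> rev (sorted_list_of_multiset A) ! 1"
proof -
  define L where "L = rev (sorted_list_of_multiset A)"
  have mset: "mset L = A" by (simp add: L_def)
  have "length L \<ge> 2" using assms mset size_mset by metis
  then obtain x y zs where L: "L = x # y # zs"
    by (cases L rule: list.exhaust[case_product]) (auto simp: Suc_le_length_iff numeral_2_eq_2)
  have "sorted_wrt (\<lambda>x y. x \<ge> y) L"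
    by (simp add: L_def sorted_wrt_rev)
  then have "\<And>b. b \<in> set (y # zs) \<Longrightarrow> b \<le> y" by (auto simp: L)
  moreover have "A - {#x#} = mset (y # zs)" "x \<in># A" using mset by (auto simp: L)
  ultimately have "b \<le> L ! 1" if "b \<in># A - {#x#}" for b
    using that by (simp add: L)
  with that[of x] \<open>x \<in># A\<close> show thesis unfolding L_def by blast
qed

lemma proots_char_poly_diagonalizable:
  fixes P :: "real mat"
  assumes P: "P \<in> carrier_mat n n" "P\<^sup>T * P = 1\<^sub>m n"
  shows "proots (char_poly (P * mat_diag n d * P\<^sup>T)) = image_mset d (mset_set {..<n})"
proof -
  have "P * P\<^sup>T = 1\<^sub>m n" using mat_mult_left_right_inverse[of "P\<^sup>T" n P] P by simp
  then have "similar_mat (P * mat_diag n d * P\<^sup>T) (mat_diag n d)"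
    using P by (intro similar_matI[of _ _ P "P\<^sup>T" n]) auto
  then have "char_poly (P * mat_diag n d * P\<^sup>T) = char_poly (mat_diag n d)"
    by (rule char_poly_similar)
  also have "\<dots> = (\<Prod>a\<leftarrow>diag_mat (mat_diag n d). [:- a, 1:])"
    by (rule char_poly_upper_triangular[of _ n]) (auto simp: mat_diag_def)
  also have "diag_mat (mat_diag n d) = map d [0..<n]"
    by (auto simp: diag_mat_def mat_diag_def)
  finally have "proots (char_poly (P * mat_diag n d * P\<^sup>T)) = (\<Sum>i\<leftarrow>[0..<n]. {#d i#})"
    using proots_prod_list[of "map (\<lambda>i. [:- d i, 1:]) [0..<n]"] by (simp add: comp_def image_iff)
  also have "\<dots> = image_mset d (mset_set {..<n})"
    by (induction n) (simp_all add: lessThan_Suc)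
  finally show ?thesis .
qed

text \<open>The vector \<open>f\<close> is chosen in the plane spanned by \<open>u\<close> and \<open>w\<close> orthogonally to an eigenvector of the
  largest eigenvalue.\<close>

lemma second_eigenvalue_plane:
  fixes A :: "real mat"
  assumes A: "A \<in> carrier_mat n n" "A\<^sup>T = A" and "n \<ge> 2"
    and u: "u \<in> carrier_vec n" and w: "w \<in> carrier_vec n"
  obtains x y f where "x \<noteq> 0 \<or> y \<noteq> 0" "f = x \<cdot>\<^sub>v u + y \<cdot>\<^sub>v w"
    "f \<bullet> (A *\<^sub>v f) \<le> nth_largest_eigenvalue 2 A * (f \<bullet> f)"
    "f \<bullet> (A *\<^sub>v f) = nth_largest_eigenvalue 2 A * (f \<bullet> f) \<longrightarrow>
      A *\<^sub>v f = nth_largest_eigenvalue 2 A \<cdot>\<^sub>v f"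
proof -
  obtain P d where P: "P \<in> carrier_mat n n" "P\<^sup>T * P = 1\<^sub>m n" and AP: "A = P * mat_diag n d * P\<^sup>T"
    using real_symmetric_orthogonally_diagonalizable[OF A] by blast
  have PP: "P * P\<^sup>T = 1\<^sub>m n" using mat_mult_left_right_inverse[of "P\<^sup>T" n P] P by simp
  define l where "l = nth_largest_eigenvalue 2 A"
  let ?M = "image_mset d (mset_set {..<n})"
  have l: "l = rev (sorted_list_of_multiset ?M) ! 1"
    by (simp add: l_def nth_largest_eigenvalue_def AP proots_char_poly_diagonalizable[OF P])
  have "size ?M \<ge> 2" using \<open>n \<ge> 2\<close> by simp
  \<comment> \<open>Only one occurrence \<open>e\<close> of the largest eigenvalue is set aside. If
    that eigenvalue is multiple, \<open>l\<close> equals it, and the other entries are still at most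
    \<open>l\<close>.\<close>
  then obtain e where e: "e \<in># ?M" "\<And>b. b \<in># ?M - {#e#} \<Longrightarrow> b \<le> l"
    unfolding l using rev_sorted_list_of_multiset_nth_1 by metis
  then obtain i0 where i0: "i0 < n" "e = d i0" by auto
  have dl: "d i \<le> l" if "i < n" "i \<noteq> i0" for i
  proof (rule e(2))
    have "mset_set {..<n} = add_mset i0 (mset_set ({..<n} - {i0}))"
      using i0 by (simp add: mset_set.remove)
    then have "?M - {#e#} = image_mset d (mset_set ({..<n} - {i0}))" by (simp add: i0)
    then show "d i \<in># ?M - {#e#}" using that by auto
  qed
  let ?p = "\<lambda>v. row P\<^sup>T i0 \<bullet> v"
  \<comment> \<open>The pair (\<open>?p w\<close>, \<open>- ?p u\<close>) solves
    \<open>x * ?p u + y * ?p w = 0\<close>. When it vanishes, the whole plane is orthogonal to the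
    eigenvector and the pair (1, 0) serves.\<close>
  define x where "x = (if ?p u = 0 \<and> ?p w = 0 then 1 else ?p w)"
  define y where "y = (if ?p u = 0 \<and> ?p w = 0 then 0 else - ?p u)"
  define f where "f = x \<cdot>\<^sub>v u + y \<cdot>\<^sub>v w"
  define c where "c = P\<^sup>T *\<^sub>v f"
  have row: "row P\<^sup>T i0 \<in> carrier_vec n" using P i0 by simp
  have f: "f \<in> carrier_vec n" using u w by (simp add: f_def)
  have c: "c \<in> carrier_vec n" using P f by (simp add: c_def)
  have fc: "f = P *\<^sub>v c"
    using assoc_mult_mat_vec[of P n n "P\<^sup>T" n f] P(1) PP f by (simp add: c_def)
  have c0: "c $ i0 = 0"
    using P i0 u w row by (simp add: c_def f_def x_def y_def scalar_prod_add_distrib[of _ n])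
  define h where "h = vec n (\<lambda>i. d i * c $ i)"
  have h: "h \<in> carrier_vec n" by (simp add: h_def)
  have Af: "A *\<^sub>v f = P *\<^sub>v h"
  proof -
    have "A *\<^sub>v f = P *\<^sub>v (mat_diag n d *\<^sub>v c)"
      using P f by (simp add: AP c_def assoc_mult_mat_vec[of _ n n _ n])
    also have "mat_diag n d *\<^sub>v c = h"
    proof (rule eq_vecI)
      fix i assume "i < dim_vec h"
      then have i: "i < n" by (simp add: h_def)
      have "(mat_diag n d *\<^sub>v c) $ i = (\<Sum>j<n. (if i = j then d j else 0) * c $ j)"
        using i c by (simp add: mat_diag_def scalar_prod_def atLeast0LessThan)
      also have "\<dots> = (\<Sum>j<n. if j = i then d i * c $ i else 0)"
        by (rule sum.cong) auto
      finally show "(mat_diag n d *\<^sub>v c) $ i = h $ i" using i by (simp add: h_def)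
    qed (simp add: h_def mat_diag_def)
    finally show ?thesis .
  qed
  have isom: "(P *\<^sub>v v) \<bullet> (P *\<^sub>v v') = v \<bullet> v'" if v: "v \<in> carrier_vec n" "v' \<in> carrier_vec n" for v v'
  proof -
    have "(P *\<^sub>v v) \<bullet> (P *\<^sub>v v') = v \<bullet> (P\<^sup>T *\<^sub>v (P *\<^sub>v v'))"
      using transpose_vec_mult_scalar[of "P\<^sup>T" n n "P *\<^sub>v v'" v] P v by simp
    also have "P\<^sup>T *\<^sub>v (P *\<^sub>v v') = v'"
      using assoc_mult_mat_vec[of "P\<^sup>T" n n P n v'] P v by simp
    finally show ?thesis .
  qed
  \<comment> \<open>In the coordinates \<open>c\<close> of the eigenbasis the gap is a weighted sum
    of squares. The only weight that can be negative is that of \<open>i0\<close>, where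
    \<open>c\<close> vanishes.\<close>
  have ff: "l * (f \<bullet> f) - f \<bullet> (A *\<^sub>v f) = (\<Sum>i<n. (l - d i) * (c $ i)\<^sup>2)"
    unfolding Af unfolding fc isom[OF c c] isom[OF c h]
    using c h by (simp add: scalar_prod_def h_def atLeast0LessThan sum_distrib_left
        sum_subtractf[symmetric] algebra_simps power2_eq_square)
  have nonneg: "(l - d i) * (c $ i)\<^sup>2 \<ge> 0" if "i < n" for i
    using dl[OF that] c0 by (cases "i = i0") auto
  show thesis
  proof (rule that)
    show "x \<noteq> 0 \<or> y \<noteq> 0" by (auto simp: x_def y_def)
    show "f = x \<cdot>\<^sub>v u + y \<cdot>\<^sub>v w" by (simp add: f_def)
    have "(\<Sum>i<n. (l - d i) * (c $ i)\<^sup>2) \<ge> 0" using nonneg by (intro sum_nonneg) auto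
    then show "f \<bullet> (A *\<^sub>v f) \<le> nth_largest_eigenvalue 2 A * (f \<bullet> f)"
      using ff unfolding l_def by simp
    show "f \<bullet> (A *\<^sub>v f) = nth_largest_eigenvalue 2 A * (f \<bullet> f) \<longrightarrow>
        A *\<^sub>v f = nth_largest_eigenvalue 2 A \<cdot>\<^sub>v f"
    proof
      assume "f \<bullet> (A *\<^sub>v f) = nth_largest_eigenvalue 2 A * (f \<bullet> f)"
      then have "(\<Sum>i<n. (l - d i) * (c $ i)\<^sup>2) = 0" using ff unfolding l_def by simp
      \<comment> \<open>In the equality case every term is zero, so \<open>c\<close> lives on the
        indices with \<open>d i = l\<close>, which makes \<open>f\<close> satisfy the eigenvector
        equation.\<close>
      then have "\<forall>i<n. (l - d i) * (c $ i)\<^sup>2 = 0"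
        using nonneg by (subst (asm) sum_nonneg_eq_0_iff) auto
      then have "h = l \<cdot>\<^sub>v c" using c by (intro eq_vecI) (auto simp: h_def)
      then show "A *\<^sub>v f = nth_largest_eigenvalue 2 A \<cdot>\<^sub>v f"
        unfolding Af using P c by (simp add: fc l_def mult_mat_vec[of _ n n])
    qed
  qed
qed

section \<open>Non-backtracking walks and the size of a side of an edge cut\<close>

definition neighbors :: "'a set set \<Rightarrow> 'a \<Rightarrow> 'a set" where
  "neighbors E v = {w. {v, w} \<in> E}"

definition nb_walk :: "'a set set \<Rightarrow> 'a list \<Rightarrow> bool" where
  "nb_walk E p \<longleftrightarrow>
     (\<forall>i. Suc i < length p \<longrightarrow> {p ! i, p ! Suc i} \<in> E) \<and>
     (\<forall>i. Suc (Suc i) < length p \<longrightarrow> p ! i \<noteq> p ! Suc (Suc i))"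

lemma nb_walk_singleton [simp]: "nb_walk E [x]"
  by (simp add: nb_walk_def)

lemma nb_walk_Cons:
  assumes "p \<noteq> []"
  shows "nb_walk E (w # p) \<longleftrightarrow> {w, hd p} \<in> E \<and> (2 \<le> length p \<longrightarrow> w \<noteq> p ! 1) \<and> nb_walk E p"
proof -
  have all_nat: "(\<forall>i. Q i) \<longleftrightarrow> Q 0 \<and> (\<forall>i. Q (Suc i))" for Q :: "nat \<Rightarrow> bool"
    by (metis nat.exhaust)
  have "(\<forall>i. Suc i < length (w # p) \<longrightarrow> {(w # p) ! i, (w # p) ! Suc i} \<in> E) \<longleftrightarrow>
      {w, hd p} \<in> E \<and> (\<forall>i. Suc i < length p \<longrightarrow> {p ! i, p ! Suc i} \<in> E)"
    using all_nat[of "\<lambda>i. Suc i < length (w # p) \<longrightarrow> {(w # p) ! i, (w # p) ! Suc i} \<in> E"] assms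
    by (simp add: hd_conv_nth)
  moreover have "(\<forall>i. Suc (Suc i) < length (w # p) \<longrightarrow> (w # p) ! i \<noteq> (w # p) ! Suc (Suc i)) \<longleftrightarrow>
      (2 \<le> length p \<longrightarrow> w \<noteq> p ! 1) \<and> (\<forall>i. Suc (Suc i) < length p \<longrightarrow> p ! i \<noteq> p ! Suc (Suc i))"
    using all_nat[of "\<lambda>i. Suc (Suc i) < length (w # p) \<longrightarrow> (w # p) ! i \<noteq> (w # p) ! Suc (Suc i)"]
    by (simp add: numeral_2_eq_2 Suc_le_eq)
  ultimately show ?thesis unfolding nb_walk_def by blast
qed

lemma nb_walk_rev: "nb_walk E p \<Longrightarrow> nb_walk E (rev p)"
  unfolding nb_walk_def
proof (intro conjI allI impI)
  fix i assume p: "(\<forall>i. Suc i < length p \<longrightarrow> {p ! i, p ! Suc i} \<in> E) \<and>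
     (\<forall>i. Suc (Suc i) < length p \<longrightarrow> p ! i \<noteq> p ! Suc (Suc i))"
  show "{rev p ! i, rev p ! Suc i} \<in> E" if "Suc i < length (rev p)"
  proof -
    let ?k = "length p - Suc (Suc i)"
    have "Suc ?k < length p" "Suc ?k = length p - Suc i" using that by auto
    then show ?thesis using p that by (metis Suc_lessD insert_commute length_rev rev_nth)
  qed
  show "rev p ! i \<noteq> rev p ! Suc (Suc i)" if "Suc (Suc i) < length (rev p)"
  proof -
    let ?k = "length p - Suc (Suc (Suc i))"
    have "Suc (Suc ?k) < length p" "Suc (Suc ?k) = length p - Suc i" using that by auto
    then show ?thesis using p that by (metis Suc_lessD length_rev rev_nth)
  qed
qed

text \<open>Every three consecutive entries lie in one of the two pieces, except those centred at
  \<open>z\<close>; there \<open>last p \<noteq> hd q\<close> rules out backtracking.\<close>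

lemma nb_walk_append:
  assumes "nb_walk E (p @ [z])" "nb_walk E (z # q)" "p \<noteq> []" "q \<noteq> []" "last p \<noteq> hd q"
  shows "nb_walk E (p @ z # q)"
  using assms
proof (induction p)
  case (Cons a p)
  show ?case
  proof (cases "p = []")
    case True
    with Cons.prems show ?thesis by (simp add: nb_walk_Cons hd_conv_nth)
  next
    case False
    then have hd: "hd (p @ [z]) = hd (p @ z # q)" and nth: "(p @ [z]) ! 1 = (p @ z # q) ! 1"
      by (cases p; auto simp: nth_append nth_Cons')+
    have "{a, hd (p @ [z])} \<in> E" "a \<noteq> (p @ [z]) ! 1" "nb_walk E (p @ [z])"
      using Cons.prems(1) False nb_walk_Cons[of "p @ [z]" E a] by (cases p; simp)+
    moreover from this have "nb_walk E (p @ z # q)" using Cons False by simp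
    ultimately show ?thesis
      using nb_walk_Cons[of "p @ z # q" E a] unfolding hd nth by simp
  qed
qed simp

lemma nb_walk_appendD: "nb_walk E (p @ q) \<Longrightarrow> nb_walk E p \<and> nb_walk E q"
proof
  assume *: "nb_walk E (p @ q)"
  show "nb_walk E p"
    using * unfolding nb_walk_def by (metis Suc_lessD length_append nth_append trans_less_add1)
  show "nb_walk E q"
    using * unfolding nb_walk_def
    by (metis add_Suc_right length_append nat_add_left_cancel_less nth_append_length_plus)
qed

text \<open>Two equal entries at the least possible distance \<open>d\<close> enclose a cycle:
  \<open>d = 1\<close> would be a loop, \<open>d = 2\<close> a backtracking step, and minimality
  makes the entries between them distinct. Its length \<open>d\<close> is less than
  \<open>length p\<close>, hence less than the girth.\<close>

lemma nb_walk_distinct: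
  assumes E: "\<And>e. e \<in> E \<Longrightarrow> card e = 2" and p: "nb_walk E p" and g: "enat (length p) \<le> girth E"
  shows "distinct p"
proof (rule ccontr)
  assume "\<not> distinct p"
  then obtain i0 j0 where ij0: "i0 < j0" "j0 < length p" "p ! i0 = p ! j0"
    unfolding distinct_conv_nth by (metis nat_neq_iff)
  let ?Q = "\<lambda>d. d > 0 \<and> (\<exists>i. i + d < length p \<and> p ! i = p ! (i + d))"
  define d where "d = (LEAST d. ?Q d)"
  have "?Q (j0 - i0)" using ij0 by (auto intro!: exI[of _ i0])
  then have "?Q d" unfolding d_def by (rule LeastI)
  then obtain i where d: "d > 0" "i + d < length p" "p ! i = p ! (i + d)" by blast
  have least: "d \<le> d'" if "?Q d'" for d' unfolding d_def by (rule Least_le[of ?Q]) (fact that)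
  define c where "c = take d (drop i p)"
  have len: "length c = d" using d by (simp add: c_def)
  have nth: "c ! k = p ! (i + k)" if "k < d" for k using that d by (simp add: c_def)
  have "d \<noteq> 1"
  proof
    assume "d = 1"
    then have "{p ! i, p ! i} \<in> E" using p d unfolding nb_walk_def by (metis Suc_eq_plus1)
    with E show False by fastforce
  qed
  moreover have "d \<noteq> 2"
    using p d unfolding nb_walk_def by (metis add_2_eq_Suc')
  ultimately have "d \<ge> 3" using d by simp
  moreover have "distinct c"
    unfolding distinct_conv_nth
  proof (intro allI impI)
    fix k l assume kl: "k < length c" "l < length c" "k \<noteq> l"
    have "c ! k \<noteq> c ! l" if "k < l" "l < d" for k l
    proof
      assume "c ! k = c ! l"
      then have "?Q (l - k)" using that d nth by (auto intro!: exI[of _ "i + k"])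
      from least[OF this] that show False by simp
    qed
    with kl show "c ! k \<noteq> c ! l" by (metis len linorder_neqE_nat)
  qed
  moreover have "{c ! k, c ! (Suc k mod length c)} \<in> E" if "k < length c" for k
  proof -
    \<comment> \<open>At the last index the successor wraps around to \<open>c ! 0 = p ! i\<close>,
      which is \<open>p ! (i + d)\<close>.\<close>
    have "c ! (Suc k mod length c) = p ! Suc (i + k)"
      using that d nth[of 0] nth[of "Suc k"] by (cases "Suc k = d") (auto simp: len)
    moreover have "{p ! (i + k), p ! Suc (i + k)} \<in> E"
      using p that d unfolding nb_walk_def by (simp add: len)
    ultimately show ?thesis using nth that len by simp
  qed
  ultimately have "is_cycle E c" by (auto simp: is_cycle_def len)
  then have "girth E \<le> enat (length c)" unfolding girth_def by (intro Inf_lower) blast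
  with g have "enat (length p) \<le> enat (length c)" by (rule order_trans)
  with d len show False by simp
qed

text \<open>Let the walks part after the vertex \<open>z\<close>. Going back along one remainder to
  \<open>z\<close> and out along the other is a non-backtracking walk with equal ends. The common
  prefix is nonempty, so this walk has at most \<open>length p + length q - 1\<close> entries; that
  is why the bound may be one more than the girth.\<close>

lemma nb_walk_unique:
  assumes E: "\<And>e. e \<in> E \<Longrightarrow> card e = 2" and p: "nb_walk E p" "p \<noteq> []" and q: "nb_walk E q" "q \<noteq> []"
    and hd: "hd p = hd q" and last: "last p = last q"
    and len: "enat (length p + length q) \<le> eSuc (girth E)"
  shows "p = q"
proof (rule ccontr)
  assume "p \<noteq> q"
  have short: "distinct r" if "nb_walk E r" "length r < length p + length q" for r
  proof (rule nb_walk_distinct[OF E that(1)])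
    have "eSuc (enat (length r)) \<le> enat (length p + length q)" using that(2) by (simp add: eSuc_enat)
    then have "eSuc (enat (length r)) \<le> eSuc (girth E)" using len by (rule order_trans)
    then show "enat (length r) \<le> girth E" by (simp only: eSuc_ile_mono)
  qed
  obtain cs p' q' where p': "p = cs @ p'" and q': "q = cs @ q'"
    and cs_max: "p' = [] \<or> q' = [] \<or> hd p' \<noteq> hd q'"
    using longest_common_prefix[of p q] by blast
  have "cs \<noteq> []" 
  proof
    assume "cs = []"
    then show False using p(2) q(2) hd p' q' cs_max by simp
  qed
  then obtain ds z where cs: "cs = ds @ [z]" by (metis rev_exhaust)
  \<comment> \<open>If one walk is a proper prefix of the other, the longer one returns to
    \<open>z\<close> and repeats a vertex by itself.\<close>
  have *: False if "r = cs" "s = cs @ u" "u \<noteq> []" "nb_walk E s" "length s < length p + length q"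
    "last r = last s" for r s u
  proof -
    have "last u = z" using that cs by simp
    then have "z \<in> set u" using that(3) last_in_set by metis
    moreover have "s = ds @ z # u" using that(2) cs by simp
    ultimately have "\<not> distinct s" by simp
    then show False using short[OF that(4,5)] by simp
  qed
  consider "p' = []" "q' \<noteq> []" | "q' = []" "p' \<noteq> []" | "p' \<noteq> []" "q' \<noteq> []"
    using \<open>p \<noteq> q\<close> p' q' by blast
  then show False
  proof cases
    case 1
    have "length q < length p + length q" using p by simp
    with 1 show False using *[of p q q'] p' q' q(1) last by simp
  next
    case 2
    have "length p < length p + length q" using q by simp
    with 2 show False using *[of q p p'] p' q' p(1) last by simp
  next
    case 3
    with cs_max have "hd p' \<noteq> hd q'" by simp
    moreover have "nb_walk E (z # p')"
      using p(1) nb_walk_appendD[of E ds "z # p'"] by (simp add: p' cs)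
    then have "nb_walk E (rev p' @ [z])" using nb_walk_rev[of E "z # p'"] by simp
    moreover have "nb_walk E (z # q')"
      using q(1) nb_walk_appendD[of E ds "z # q'"] by (simp add: q' cs)
    ultimately have "nb_walk E (rev p' @ z # q')"
      using 3 nb_walk_append[of E "rev p'" z q'] by (simp add: last_rev)
    then have "distinct (rev p' @ z # q')"
      by (rule short) (simp add: p' q' cs)
    moreover have "last p' \<in> set p'" using 3 by simp
    moreover have "last p' = last q'" using 3 last by (simp add: p' q')
    then have "last p' \<in> set q'" using 3 by simp
    ultimately show False by auto
  qed
qed

text \<open>Walks are extended at their head: the last list element is the starting point.\<close>

definition extend_walks :: "'a set set \<Rightarrow> 'a set \<Rightarrow> 'a list set \<Rightarrow> 'a list set" where
  "extend_walks E S P = {w # p | w p. p \<in> P \<and> w \<in> S \<and> nb_walk E (w # p)}"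

text \<open>Summed over \<open>S\<close>, this counts each edge leaving \<open>S\<close> once, so
  the size of a cut becomes a sum over vertices.\<close>

definition outdeg :: "'a set set \<Rightarrow> 'a set \<Rightarrow> 'a \<Rightarrow> nat" where
  "outdeg E S v = card (neighbors E v - S)"

lemma extend_walks_mono: "P \<subseteq> Q \<Longrightarrow> extend_walks E S P \<subseteq> extend_walks E S Q"
  by (auto simp: extend_walks_def)

lemma extend_walks_funpow_mono: "P \<subseteq> Q \<Longrightarrow> (extend_walks E S ^^ j) P \<subseteq> (extend_walks E S ^^ j) Q"
  by (induction j) (simp_all add: extend_walks_mono)

lemma finite_extend_walks_funpow: "finite S \<Longrightarrow> finite P \<Longrightarrow> finite ((extend_walks E S ^^ j) P)"
proof (induction j)
  case (Suc j)
  have "extend_walks E S Q \<subseteq> (\<lambda>(w, p). w # p) ` (S \<times> Q)" for Q by (auto simp: extend_walks_def)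
  from finite_subset[OF this] Suc show ?case by simp
qed simp

lemma extend_walks_funpowD:
  assumes "p \<in> (extend_walks E S ^^ j) P" "\<And>q. q \<in> P \<Longrightarrow> nb_walk E q \<and> set q \<subseteq> S"
  obtains c q where "q \<in> P" "p = c @ q" "length c = j" "nb_walk E p" "set p \<subseteq> S"
proof -
  have "\<exists>c. \<exists>q\<in>P. p = c @ q \<and> length c = j \<and> nb_walk E p \<and> set p \<subseteq> S"
    using assms(1)
  proof (induction j arbitrary: p)
    case (Suc j)
    then obtain w r where p: "p = w # r" "w \<in> S" "nb_walk E p" and r: "r \<in> (extend_walks E S ^^ j) P"
      by (auto simp: extend_walks_def[of E S "(extend_walks E S ^^ j) P"])
    from Suc.IH[OF r] obtain c q where "q \<in> P" "r = c @ q" "length c = j" "set r \<subseteq> S" by blast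
    with p show ?case by (intro exI[of _ "w # c"] bexI[of _ q]) auto
  qed (use assms(2) in auto)
  with that show thesis by blast
qed

text \<open>A loss of \<open>b j\<close> at level \<open>j\<close> costs at most \<open>b j * m ^ (i - j - 1)\<close> at level \<open>i\<close>, so it is worst
  to spend the whole budget at level 1.\<close>

lemma level_growth:
  fixes l b :: "nat \<Rightarrow> nat" and d :: nat
  assumes one: "Suc m \<le> l 1" and step: "\<And>j. 1 \<le> j \<Longrightarrow> j < t \<Longrightarrow> m * l j \<le> l (Suc j) + b j"
    and budget: "(\<Sum>j\<in>{1..<t}. b j) \<le> m" and "m > 0"
    and j: "2 \<le> j" "j \<le> t"
  shows "m ^ j \<le> l j"
proof -
  \<comment> \<open>The first level has \<open>Suc m\<close> elements instead of \<open>m\<close>.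
    This surplus has grown to \<open>m ^ (j - 1)\<close> at level \<open>j\<close>, exactly what a
    total loss of \<open>m\<close> can consume.\<close>
  have "Suc m * m ^ (j - 1) \<le> l j + (\<Sum>i\<in>{1..<j}. b i) * m ^ (j - 2)" using j
  proof (induction j rule: dec_induct)
    case base
    have "m * Suc m \<le> m * l 1" using one by (rule mult_le_mono2)
    also have "\<dots> \<le> l (Suc 1) + b 1" using step[of 1] base by simp
    finally show ?case by (simp add: numeral_2_eq_2 mult.commute)
  next
    case (step j)
    let ?B = "\<Sum>i\<in>{1..<j}. b i"
    from step(1) obtain i where i: "j = Suc (Suc i)" by (metis add_2_eq_Suc le_Suc_ex)
    have "Suc m * m ^ j = m * (Suc m * m ^ (j - 1))" using i by (simp add: algebra_simps)
    also have "\<dots> \<le> m * (l j + ?B * m ^ (j - 2))" using step by simp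
    also have "\<dots> = m * l j + ?B * m ^ (j - 1)" using i by (simp add: algebra_simps)
    also have "\<dots> \<le> l (Suc j) + b j * 1 + ?B * m ^ (j - 1)" using assms(2)[of j] step by simp
    also have "\<dots> \<le> l (Suc j) + b j * m ^ (j - 1) + ?B * m ^ (j - 1)"
      using \<open>m > 0\<close> by (intro add_mono mult_le_mono) auto
    also have "\<dots> = l (Suc j) + (\<Sum>i\<in>{1..<Suc j}. b i) * m ^ (Suc j - 2)"
      using i by (simp add: algebra_simps)
    finally show ?case by simp
  qed
  also have "(\<Sum>i\<in>{1..<j}. b i) \<le> (\<Sum>i\<in>{1..<t}. b i)" using j by (intro sum_mono2) auto
  then have "(\<Sum>i\<in>{1..<j}. b i) * m ^ (j - 2) \<le> m * m ^ (j - 2)" using budget by simp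
  also have "m * m ^ (j - 2) = m ^ (j - 1)" using j(1) by (metis Suc_1 Suc_diff_le diff_Suc_Suc power_Suc)
  also have "Suc m * m ^ (j - 1) = m ^ j + m ^ (j - 1)"
    using j(1) by (cases j) auto
  finally show ?thesis by simp
qed

text \<open>The assumptions concern a single side of a cut with fewer than \<open>\<delta>\<close>
  edges, so that both sides can be interpreted as instances.\<close>

locale small_edge_boundary =
  fixes E :: "'a set set" and S :: "'a set" and \<delta> :: nat
  assumes edge_card: "e \<in> E \<Longrightarrow> card e = 2"
    and finite_S: "finite S" and nonempty: "S \<noteq> {}"
    and finite_neighbors: "v \<in> S \<Longrightarrow> finite (neighbors E v)"
    and degree: "v \<in> S \<Longrightarrow> \<delta> \<le> card (neighbors E v)"
    and boundary: "(\<Sum>v\<in>S. outdeg E S v) < \<delta>"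
begin

lemma self_notin_neighbors: "v \<notin> neighbors E v"
  using edge_card[of "{v, v}"] by (auto simp: neighbors_def)

lemma card_neighbors: "v \<in> S \<Longrightarrow> card (neighbors E v) = card (neighbors E v \<inter> S) + outdeg E S v"
  unfolding outdeg_def using finite_neighbors[of v] by (metis card_Int_Diff)

text \<open>Otherwise take any \<open>v\<close> in \<open>S\<close>: its own cut edges, together
  with at least one at each neighbour inside \<open>S\<close>, number at least the degree of
  \<open>v\<close>, hence at least \<open>\<delta>\<close>.\<close>

lemma interior_vertex: obtains x where "x \<in> S" "outdeg E S x = 0"
proof -
  have "\<exists>x\<in>S. outdeg E S x = 0"
  proof (rule ccontr)
    assume "\<not> (\<exists>x\<in>S. outdeg E S x = 0)"
    then have pos: "1 \<le> outdeg E S u" if "u \<in> S" for u using that by (simp add: Suc_le_eq)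
    obtain v where v: "v \<in> S" using nonempty by blast
    let ?N = "neighbors E v \<inter> S"
    have "card ?N = (\<Sum>u\<in>?N. 1)" by simp
    also have "\<dots> \<le> (\<Sum>u\<in>?N. outdeg E S u)" using pos by (intro sum_mono) simp
    finally have "card ?N + outdeg E S v \<le> (\<Sum>u\<in>insert v ?N. outdeg E S u)"
      using finite_S self_notin_neighbors[of v] by (subst sum.insert) auto
    also have "\<dots> \<le> (\<Sum>u\<in>S. outdeg E S u)" using finite_S v by (intro sum_mono2) auto
    finally show False using boundary card_neighbors[OF v] degree[OF v] by linarith
  qed
  with that show thesis by blast
qed

text \<open>At the head of a walk at least \<open>\<delta>\<close> neighbours are available; one is
  lost to backtracking and \<open>outdeg\<close> many lie outside \<open>S\<close>. Since
  \<open>2 \<le> length p\<close>, the entry \<open>p ! 1\<close> is the predecessor that must be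
  avoided. The losses stand on the right to avoid truncated subtraction.\<close>

lemma card_extend_walks:
  assumes "finite P" and P: "\<And>p. p \<in> P \<Longrightarrow> nb_walk E p \<and> set p \<subseteq> S \<and> 2 \<le> length p"
  shows "(\<delta> - 1) * card P \<le> card (extend_walks E S P) + (\<Sum>p\<in>P. outdeg E S (hd p))"
proof -
  define X where "X p = neighbors E (hd p) \<inter> S - {p ! 1}" for p
  have "extend_walks E S P = (\<lambda>(p, w). w # p) ` Sigma P X"
  proof -
    have "nb_walk E (w # p) \<longleftrightarrow> w \<in> neighbors E (hd p) - {p ! 1}" if "p \<in> P" for w p
      using P[OF that] nb_walk_Cons[of p E w]
      by (cases "p = []") (auto simp: neighbors_def insert_commute)
    then show ?thesis by (force simp: extend_walks_def X_def)
  qed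
  moreover have "inj_on (\<lambda>(p, w). w # p) (Sigma P X)" by (auto simp: inj_on_def)
  ultimately have "card (extend_walks E S P) = card (Sigma P X)" by (simp add: card_image)
  also have "\<dots> = (\<Sum>p\<in>P. card (X p))"
    using assms(1) finite_S by (simp add: X_def)
  finally have card_eq: "card (extend_walks E S P) = (\<Sum>p\<in>P. card (X p))" .
  have "\<delta> - 1 \<le> card (X p) + outdeg E S (hd p)" if "p \<in> P" for p
  proof -
    have hd: "hd p \<in> S" using P[OF that] by (metis hd_in_set list.size(3) not_numeral_le_zero subsetD)
    have "card (neighbors E (hd p) \<inter> S) \<le> Suc (card (X p))"
    proof -
      have fin: "finite (X p)" using finite_S by (simp add: X_def)
      have "card (neighbors E (hd p) \<inter> S) \<le> card (insert (p ! 1) (X p))"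
        using fin by (intro card_mono) (auto simp: X_def)
      then show ?thesis using fin by (simp add: card_insert_if split: if_splits)
    qed
    then show ?thesis using card_neighbors[OF hd] degree[OF hd] by linarith
  qed
  then have "(\<Sum>p\<in>P. \<delta> - 1) \<le> (\<Sum>p\<in>P. card (X p) + outdeg E S (hd p))" by (rule sum_mono)
  then show ?thesis by (simp add: card_eq sum.distrib mult.commute)
qed

lemma n1_star_le_card:
  assumes g: "girth E = enat g" "g \<ge> 3" and "\<delta> \<ge> 2"
  shows "n1_star \<delta> g \<le> card S"
proof -
  define t where "t = (g - 1) div 2"
  define m where "m = \<delta> - 1"
  have t: "t \<ge> 1" "2 * t + 1 \<le> g" using g(2) by (auto simp: t_def)
  have m: "m > 0" "\<delta> = Suc m" using \<open>\<delta> \<ge> 2\<close> by (auto simp: m_def)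
  obtain x where x: "x \<in> S" "outdeg E S x = 0" by (rule interior_vertex)
  have Nx: "neighbors E x \<subseteq> S"
    using x finite_neighbors by (simp add: outdeg_def)
  define L where "L j = (extend_walks E S ^^ j) {[x]}" for j
  have finL: "finite (L j)" for j unfolding L_def by (rule finite_extend_walks_funpow) (simp_all add: finite_S)
  have L: "nb_walk E p \<and> set p \<subseteq> S \<and> length p = Suc j \<and> last p = x" if "p \<in> L j" for p j
    using extend_walks_funpowD[OF that[unfolded L_def]] x(1) by (metis empty_iff empty_set insert_iff
        last_snoc length_append_singleton list.simps(15) nb_walk_singleton subsetI)
  have L1: "L 1 = (\<lambda>w. [w, x]) ` neighbors E x"
    using Nx by (auto simp: L_def extend_walks_def nb_walk_Cons neighbors_def insert_commute)
  have card_L1: "\<delta> \<le> card (L 1)"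
    unfolding L1 using degree[OF x(1)] by (subst card_image) (auto simp: inj_on_def)
  define U where "U = (\<Union>j\<in>{..t}. L j)"
  have U: "nb_walk E p \<and> set p \<subseteq> S \<and> p \<noteq> [] \<and> length p \<le> Suc t \<and> last p = x" if "p \<in> U" for p
    using that L unfolding U_def by fastforce
  have finU: "finite U" using finL by (simp add: U_def)
  \<comment> \<open>Lengths count vertices: two walks with at most \<open>t\<close> edges have
    together at most \<open>2 * t + 2\<close> entries, which is at most
    \<open>Suc g\<close>.\<close>
  have unique: "p = q" if "nb_walk E p" "nb_walk E q" "p \<noteq> []" "q \<noteq> []" "hd p = hd q" "last p = last q"
    "length p + length q \<le> Suc g" for p q
    using nb_walk_unique[OF edge_card that(1,3,2,4-6)] that(7) by (simp add: g(1) eSuc_enat)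
  have injU: "inj_on hd U"
  proof (rule inj_onI)
    fix p q assume "p \<in> U" "q \<in> U" "hd p = hd q"
    then show "p = q" using U[of p] U[of q] t by (intro unique) auto
  qed
  have sumU: "(\<Sum>p\<in>U. f p) = (\<Sum>j\<le>t. \<Sum>p\<in>L j. f p)" for f :: "'a list \<Rightarrow> nat"
    unfolding U_def
  proof (rule sum.UNION_disjoint)
    show "\<forall>i\<in>{..t}. \<forall>j\<in>{..t}. i \<noteq> j \<longrightarrow> L i \<inter> L j = {}"
      using L by (metis disjoint_iff nat.inject)
  qed (use finL in auto)
  have hdU: "hd ` U \<subseteq> S"
    using U by (metis hd_in_set image_subsetI subsetD)
  define b where "b j = (\<Sum>p\<in>L j. outdeg E S (hd p))" for j
  \<comment> \<open>Walks in \<open>U\<close> have different heads, so the losses of all levels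
    together are charged to distinct vertices of \<open>S\<close> and stay within the size of the
    cut.\<close>
  have "(\<Sum>j\<le>t. b j) = (\<Sum>v\<in>hd ` U. outdeg E S v)"
    unfolding b_def sumU[symmetric] using injU by (simp add: sum.reindex)
  also have "\<dots> \<le> (\<Sum>v\<in>S. outdeg E S v)" using hdU finite_S by (intro sum_mono2) auto
  finally have "(\<Sum>j\<le>t. b j) \<le> m" using boundary m by simp
  moreover have "(\<Sum>j\<in>{1..<t}. b j) \<le> (\<Sum>j\<le>t. b j)" by (intro sum_mono2) auto
  ultimately have budget: "(\<Sum>j\<in>{1..<t}. b j) \<le> m" by simp
  have step: "m * card (L j) \<le> card (L (Suc j)) + b j" if "j \<ge> 1" for j
    using card_extend_walks[of "L j"] finL L that unfolding m_def b_def by (fastforce simp: L_def)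
  have growth: "m ^ j \<le> card (L j)" if "2 \<le> j" "j \<le> t" for j
    using level_growth[of m "\<lambda>j. card (L j)" t b j] card_L1 step budget m that by simp
  \<comment> \<open>Levels 0 and 1 contribute the summands 1 and \<open>\<delta>\<close> of
    \<open>n1_star\<close>; the growth estimate starts at level 2.\<close>
  have "{..t} = {0, 1} \<union> {2..t}" using t by auto
  then have "card U = card (L 0) + card (L 1) + (\<Sum>j=2..t. card (L j))"
    using sumU[of "\<lambda>_. 1"] by (simp add: sum.union_disjoint)
  moreover have "card (L 0) = 1" by (simp add: L_def)
  moreover have "(\<Sum>j=2..t. m ^ j) \<le> (\<Sum>j=2..t. card (L j))"
    using growth by (intro sum_mono) simp
  ultimately have cardU: "1 + \<delta> + (\<Sum>j=2..t. m ^ j) \<le> card U" using card_L1 by linarith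
  show ?thesis
  proof (cases "g = 2 * t + 1")
    case True
    then have "n1_star \<delta> g = 1 + \<delta> + (\<Sum>j=2..t. m ^ j)"
      by (simp add: n1_star_def Let_def t_def m_def)
    also have "\<dots> \<le> card U" by (fact cardU)
    also have "\<dots> = card (hd ` U)" using injU by (simp add: card_image)
    also have "\<dots> \<le> card S" using hdU finite_S by (simp add: card_mono)
    finally show ?thesis .
  next
    case False
    then have g_eq: "g = 2 * t + 2" using g(2) by (simp add: t_def)
    have branch: "nb_walk E [y, x] \<and> set [y, x] \<subseteq> S" if "y \<in> neighbors E x" for y
      using that x(1) Nx by (auto simp: nb_walk_Cons neighbors_def insert_commute)
    have branch_U: "(extend_walks E S ^^ j) {[y, x]} \<subseteq> U" if "y \<in> neighbors E x" "j < t" for y j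
    proof -
      have "(extend_walks E S ^^ j) {[y, x]} \<subseteq> (extend_walks E S ^^ j) (L 1)"
        by (rule extend_walks_funpow_mono) (use that L1 in auto)
      also have "\<dots> = L (Suc j)" by (simp add: L_def funpow_swap1)
      finally show ?thesis using that(2) unfolding U_def by force
    qed
    \<comment> \<open>Otherwise each neighbour \<open>y\<close> has a walk \<open>h y\<close>
      through its branch whose head has a cut edge. Heads determine walks and a walk determines its
      branch, so these are at least \<open>\<delta>\<close> different vertices with cut edges. The
      bound \<open>j < t\<close> keeps the walks, which have \<open>j + 1\<close> edges, inside
      \<open>U\<close>.\<close>
    have "\<exists>y\<in>neighbors E x. \<forall>j<t. \<forall>p\<in>(extend_walks E S ^^ j) {[y, x]}. outdeg E S (hd p) = 0"
    proof (rule ccontr)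
      assume "\<not> ?thesis"
      then have "\<forall>y\<in>neighbors E x. \<exists>p. \<exists>j<t. p \<in> (extend_walks E S ^^ j) {[y, x]} \<and> outdeg E S (hd p) \<noteq> 0"
        by blast
      then obtain h where h: "\<And>y. y \<in> neighbors E x \<Longrightarrow>
          \<exists>j<t. h y \<in> (extend_walks E S ^^ j) {[y, x]} \<and> outdeg E S (hd (h y)) \<noteq> 0"
        by metis
      have "inj_on (\<lambda>y. hd (h y)) (neighbors E x)"
      proof (rule inj_onI)
        fix y z assume y: "y \<in> neighbors E x" and z: "z \<in> neighbors E x" and eq: "hd (h y) = hd (h z)"
        have "h y = h z" using injU eq h[OF y] h[OF z] branch_U[OF y] branch_U[OF z]
          by (metis inj_onD subsetD)
        moreover obtain c where "h y = c @ [y, x]"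
          using h[OF y] extend_walks_funpowD[of "h y" _ E S "{[y, x]}"] branch[OF y] by (metis singletonD)
        moreover obtain c' where "h z = c' @ [z, x]"
          using h[OF z] extend_walks_funpowD[of "h z" _ E S "{[z, x]}"] branch[OF z] by (metis singletonD)
        ultimately show "y = z" by simp
      qed
      then have "card (neighbors E x) = (\<Sum>v\<in>(\<lambda>y. hd (h y)) ` neighbors E x. 1)"
        by (simp add: card_image)
      also have "\<dots> \<le> (\<Sum>v\<in>(\<lambda>y. hd (h y)) ` neighbors E x. outdeg E S v)"
        using h by (intro sum_mono) (fastforce simp: Suc_le_eq)
      also have "\<dots> \<le> (\<Sum>v\<in>S. outdeg E S v)"
        using finite_S h branch_U hdU by (intro sum_mono2) blast+
      finally show False using boundary degree[OF x(1)] by simp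
    qed
    then obtain y where y: "y \<in> neighbors E x"
      and y0: "\<And>j p. j < t \<Longrightarrow> p \<in> (extend_walks E S ^^ j) {[y, x]} \<Longrightarrow> outdeg E S (hd p) = 0" by blast
    define Q where "Q j = (extend_walks E S ^^ j) {[y, x]}" for j
    have finQ: "finite (Q j)" for j unfolding Q_def by (rule finite_extend_walks_funpow) (simp_all add: finite_S)
    have Q: "nb_walk E p \<and> set p \<subseteq> S \<and> (\<exists>c. p = c @ [y, x] \<and> length c = j)" if "p \<in> Q j" for p j
      using extend_walks_funpowD[OF that[unfolded Q_def]] branch[OF y] by (metis singletonD)
    have "m ^ j \<le> card (Q j)" if "j \<le> t" for j
      using that
    proof (induction j)
      case (Suc j)
      have "m * m ^ j \<le> m * card (Q j)" using Suc by simp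
      also have "\<dots> \<le> card (extend_walks E S (Q j)) + (\<Sum>p\<in>Q j. outdeg E S (hd p))"
        unfolding m_def by (rule card_extend_walks) (use finQ Q in fastforce)+
      also have "\<dots> = card (Q (Suc j))" using y0[of j] Suc.prems by (simp add: Q_def)
      finally show ?case by simp
    qed (simp add: Q_def)
    then have cardQ: "m ^ t \<le> card (Q t)" by simp
    \<comment> \<open>Walks in \<open>Q t\<close> have \<open>t + 2\<close> entries, those in
      \<open>U\<close> at most \<open>t + 1\<close>.\<close>
    have "U \<inter> Q t = {}" using U Q by fastforce
    then have "card (U \<union> Q t) = card U + card (Q t)" using finU finQ by (simp add: card_Un_disjoint)
    moreover have "inj_on hd (U \<union> Q t)"
    proof -
      \<comment> \<open>Here the total length is at most \<open>2 * t + 3 = g + 1\<close>, just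
        within the bound of \<open>unique\<close>.\<close>
      have 1: "p = q" if "p \<in> U" "q \<in> Q t" "hd p = hd q" for p q
      proof (rule unique)
        show "length p + length q \<le> Suc g" using U[OF that(1)] Q[OF that(2)] g_eq by auto
      qed (use U[OF that(1)] Q[OF that(2)] that(3) in auto)
      have 2: "p = q" if pq: "p \<in> Q t" "q \<in> Q t" "hd p = hd q" for p q
      proof -
        obtain c where c: "p = c @ [y, x]" "length c = t" "nb_walk E p" using Q[OF pq(1)] by blast
        obtain d where d: "q = d @ [y, x]" "length d = t" "nb_walk E q" using Q[OF pq(2)] by blast
        \<comment> \<open>Two walks of \<open>Q t\<close> have \<open>g + 2\<close> entries
          together, one too many for \<open>unique\<close>. Both end in \<open>[y, x]\<close>, so
          \<open>x\<close> is dropped and the truncated walks are compared as walks from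
          \<open>y\<close>.\<close>
        have "c @ [y] = d @ [y]"
        proof (rule unique)
          show "nb_walk E (c @ [y])" "nb_walk E (d @ [y])"
            using c d nb_walk_appendD[of E "c @ [y]" "[x]"] nb_walk_appendD[of E "d @ [y]" "[x]"] by auto
          show "hd (c @ [y]) = hd (d @ [y])" using pq(3) c d by (simp add: hd_append split: if_splits)
        qed (use c d g_eq in auto)
        then show ?thesis using c d by simp
      qed
      show ?thesis
      proof (rule inj_onI)
        fix p q assume "p \<in> U \<union> Q t" "q \<in> U \<union> Q t" "hd p = hd q"
        then show "p = q" using 1[of p q] 1[of q p] 2[of p q] inj_onD[OF injU, of p q] by auto
      qed
    qed
    moreover have "hd ` (U \<union> Q t) \<subseteq> S"
    proof -
      have "hd p \<in> S" if "p \<in> Q t" for p using Q[OF that] by (cases p) auto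
      with hdU show ?thesis by auto
    qed
    ultimately have "card U + card (Q t) \<le> card S"
      using finite_S by (metis card_image card_mono)
    \<comment> \<open>Since \<open>1 + \<delta> = 2 + m\<close>, the extra \<open>m\<close> fills
      the sum from index 1, and splitting off its last term \<open>m ^ t\<close> gives the even case
      of \<open>n1_star\<close>.\<close>
    moreover have "n1_star \<delta> g = 1 + \<delta> + (\<Sum>j=2..t. m ^ j) + m ^ t"
    proof -
      have "(\<Sum>j=1..t. m ^ j) = m + (\<Sum>j=2..t. m ^ j)"
        using t(1) by (simp add: sum.atLeast_Suc_atMost numeral_2_eq_2)
      moreover have "(\<Sum>j=1..t. m ^ j) = (\<Sum>j=1..t-1. m ^ j) + m ^ t"
        using t(1) by (cases t) auto
      moreover have "n1_star \<delta> g = 2 + 2 * m ^ t + (\<Sum>j=1..t-1. m ^ j)"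
        using False by (simp add: n1_star_def Let_def t_def m_def)
      ultimately show ?thesis using m(2) by simp
    qed
    ultimately show ?thesis using cardU cardQ by linarith
  qed
qed

end

section \<open>The spectral bound for edge cuts\<close>

lemma neighbors_sym: "w \<in> neighbors E v \<longleftrightarrow> v \<in> neighbors E w"
  by (simp add: neighbors_def insert_commute)

lemma simple_graph_neighbors:
  assumes "simple_graph V E"
  shows "neighbors E v \<subseteq> V" "finite (neighbors E v)" "v \<notin> neighbors E v"
    "vdegree E v = card (neighbors E v)"
proof -
  have E: "e \<subseteq> V" "card e = 2" if "e \<in> E" for e using assms that by (auto simp: simple_graph_def)
  show sub: "neighbors E v \<subseteq> V" using E(1) by (auto simp: neighbors_def)
  show "finite (neighbors E v)" using sub assms by (auto simp: simple_graph_def intro: finite_subset)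
  show self: "v \<notin> neighbors E v" using E(2)[of "{v, v}"] by (auto simp: neighbors_def)
  have "(\<lambda>w. {v, w}) ` neighbors E v = {e \<in> E. v \<in> e}"
  proof
    show "{e \<in> E. v \<in> e} \<subseteq> (\<lambda>w. {v, w}) ` neighbors E v"
    proof
      fix e assume e: "e \<in> {e \<in> E. v \<in> e}"
      then obtain x y where "e = {x, y}" using E(2)[of e] by (auto simp: card_2_iff)
      with e show "e \<in> (\<lambda>w. {v, w}) ` neighbors E v"
        by (auto simp: neighbors_def insert_commute)
    qed
  qed (auto simp: neighbors_def)
  moreover have "inj_on (\<lambda>w. {v, w}) (neighbors E v)" by (auto simp: inj_on_def doubleton_eq_iff)
  ultimately show "vdegree E v = card (neighbors E v)"
    unfolding vdegree_def by (metis card_image)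
qed

lemma sum_outdeg:
  assumes "finite S" "\<And>v. v \<in> S \<Longrightarrow> finite (neighbors E v)"
  shows "(\<Sum>v\<in>S. outdeg E S v) = card (SIGMA v:S. neighbors E v - S)"
  using assms by (simp add: outdeg_def)

text \<open>Cut edges are ordered pairs with first component on the given side; swapping the
  components exchanges the two sides.\<close>

lemma sum_outdeg_complement:
  assumes G: "simple_graph V E" and "S \<subseteq> V"
  shows "(\<Sum>v\<in>V - S. outdeg E (V - S) v) = (\<Sum>v\<in>S. outdeg E S v)"
proof -
  have fin: "finite S" "finite (V - S)"
    using G \<open>S \<subseteq> V\<close> by (auto simp: simple_graph_def intro: finite_subset)
  have "prod.swap ` (SIGMA v:S. neighbors E v - S) = (SIGMA v:V - S. neighbors E v - (V - S))"
  proof (rule Set.set_eqI)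
    fix p :: "'a \<times> 'a"
    obtain v w where p: "p = (v, w)" by (cases p)
    have "p \<in> prod.swap ` (SIGMA v:S. neighbors E v - S) \<longleftrightarrow> w \<in> S \<and> v \<in> neighbors E w \<and> v \<notin> S"
      by (auto simp: p image_iff)
    also have "\<dots> \<longleftrightarrow> v \<in> V - S \<and> w \<in> neighbors E v \<and> w \<notin> V - S"
      using simple_graph_neighbors(1)[OF G, of w] simple_graph_neighbors(1)[OF G, of v] \<open>S \<subseteq> V\<close>
        neighbors_sym[of v E w] by blast
    finally show "p \<in> prod.swap ` (SIGMA v:S. neighbors E v - S) \<longleftrightarrow>
        p \<in> (SIGMA v:V - S. neighbors E v - (V - S))"
      by (simp add: p)
  qed
  moreover have "inj_on prod.swap (SIGMA v:S. neighbors E v - S)" by (simp add: inj_on_def)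
  ultimately have "card (SIGMA v:V - S. neighbors E v - (V - S)) = card (SIGMA v:S. neighbors E v - S)"
    by (metis card_image)
  then show ?thesis
    using simple_graph_neighbors(2)[OF G] fin by (simp only: sum_outdeg)
qed

lemma sum_vertex_list:
  assumes "finite V"
  shows "(\<Sum>i<card V. h (vertex_list V ! i)) = (\<Sum>v\<in>V. h v)"
proof -
  have "length (vertex_list V) = card V"
    using vertex_list[OF assms] distinct_card by metis
  then have "bij_betw ((!) (vertex_list V)) {..<card V} V"
    using vertex_list[OF assms] by (intro bij_betw_nth) auto
  then show ?thesis by (rule sum.reindex_bij_betw)
qed

section \<open>The matrix \<open>a D + A\<close> acting on functions on the vertices\<close>

lemma graph_matrix_symmetric:
  "a \<cdot>\<^sub>m degree_matrix V E + adjacency_matrix V E \<in> carrier_mat (card V) (card V)"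
  "(a \<cdot>\<^sub>m degree_matrix V E + adjacency_matrix V E)\<^sup>T = a \<cdot>\<^sub>m degree_matrix V E + adjacency_matrix V E"
  by (auto simp: degree_matrix_def adjacency_matrix_def insert_commute intro!: eq_matI)

lemma graph_matrix_mult_vec:
  assumes G: "simple_graph V E" and i: "i < card V"
  shows "((a \<cdot>\<^sub>m degree_matrix V E + adjacency_matrix V E) *\<^sub>v vec (card V) (\<lambda>j. F (vertex_list V ! j))) $ i
    = a * real (card (neighbors E (vertex_list V ! i))) * F (vertex_list V ! i)
      + (\<Sum>w\<in>neighbors E (vertex_list V ! i). F w)"
proof -
  let ?v = "\<lambda>i. vertex_list V ! i"
  have fin: "finite V" using G by (simp add: simple_graph_def)
  have "((a \<cdot>\<^sub>m degree_matrix V E + adjacency_matrix V E) *\<^sub>v vec (card V) (\<lambda>j. F (?v j))) $ i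
      = (\<Sum>j<card V. (if i = j then a * real (vdegree E (?v i)) * F (?v i) else 0)
          + (if ?v j \<in> neighbors E (?v i) then F (?v j) else 0))"
    using i by (auto simp: scalar_prod_def degree_matrix_def adjacency_matrix_def neighbors_def
        atLeast0LessThan algebra_simps intro!: sum.cong)
  also have "\<dots> = a * real (vdegree E (?v i)) * F (?v i)
      + (\<Sum>w\<in>V. if w \<in> neighbors E (?v i) then F w else 0)"
    using i sum_vertex_list[OF fin, of "\<lambda>w. if w \<in> neighbors E (?v i) then F w else 0"]
    by (simp add: sum.distrib)
  also have "(\<Sum>w\<in>V. if w \<in> neighbors E (?v i) then F w else 0) = (\<Sum>w\<in>V \<inter> neighbors E (?v i). F w)"
    using fin by (simp add: sum.inter_restrict)
  also have "V \<inter> neighbors E (?v i) = neighbors E (?v i)"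
    using simple_graph_neighbors(1)[OF G] by blast
  finally show ?thesis by (simp add: simple_graph_neighbors(4)[OF G])
qed

text \<open>The equality case is what turns the non-strict hypothesis of part (i) into a contradiction:
  a test function that is constant on both sides and attains the bound is an eigenvector, and
  at a vertex all of whose neighbours lie on its own side this forces the eigenvalue
  \<open>(a + 1) * deg v\<close>.\<close>

lemma second_eigenvalue_edge_cut:
  fixes a :: real
  assumes G: "simple_graph V E" and S: "S \<subseteq> V"
    and \<delta>: "\<And>v. v \<in> V \<Longrightarrow> \<delta> \<le> card (neighbors E v)" and a: "a \<ge> -1"
    and x0: "x0 \<in> S" "outdeg E S x0 = 0" and y0: "y0 \<in> V - S" "outdeg E (V - S) y0 = 0"
  defines "\<mu> \<equiv> (a + 1) * real \<delta>
      - real (\<Sum>v\<in>S. outdeg E S v) * (1 / real (card S) + 1 / real (card (V - S)))"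
  shows "\<mu> \<le> graph_eigenvalue 2 V E a"
    and "graph_eigenvalue 2 V E a = \<mu> \<Longrightarrow> (a + 1) * real \<delta> \<le> graph_eigenvalue 2 V E a"
proof -
  define n T where "n = card V" and "T = V - S"
  define M where "M = a \<cdot>\<^sub>m degree_matrix V E + adjacency_matrix V E"
  define l where "l = graph_eigenvalue 2 V E a"
  define s t m where "s = real (card S)" and "t = real (card T)"
    and "m = real (\<Sum>v\<in>S. outdeg E S v)"
  let ?v = "\<lambda>i. vertex_list V ! i"
  have fin: "finite V" "finite S" "finite T"
    using G S by (auto simp: simple_graph_def T_def intro: finite_subset)
  have V: "V = S \<union> T" "S \<inter> T = {}" using S by (auto simp: T_def)
  have pos: "s > 0" "t > 0" using x0 y0 fin by (auto simp: s_def t_def T_def card_gt_0_iff)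
  have n2: "n \<ge> 2"
    using pos fin V by (simp add: n_def s_def t_def card_Un_disjoint)
  have len: "length (vertex_list V) = n"
    using vertex_list[OF fin(1)] distinct_card n_def by metis
  have mem: "?v i \<in> V" if "i < n" for i
    using that len vertex_list(2)[OF fin(1)] nth_mem by metis
  have idx: "\<exists>i<n. ?v i = v" if "v \<in> V" for v
    using that len vertex_list(2)[OF fin(1)] by (metis in_set_conv_nth)
  have M: "M \<in> carrier_mat n n" "M\<^sup>T = M"
    using graph_matrix_symmetric[of a V E] by (simp_all add: M_def n_def)
  have l: "l = nth_largest_eigenvalue 2 M" by (simp add: l_def M_def graph_eigenvalue_def)
  let ?ind = "\<lambda>A. vec n (\<lambda>i. if ?v i \<in> A then 1 else 0 :: real)"
  obtain x y f where xy: "x \<noteq> 0 \<or> y \<noteq> 0" and f: "f = x \<cdot>\<^sub>v ?ind S + y \<cdot>\<^sub>v ?ind T"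
    and le: "f \<bullet> (M *\<^sub>v f) \<le> l * (f \<bullet> f)"
    and eq: "f \<bullet> (M *\<^sub>v f) = l * (f \<bullet> f) \<longrightarrow> M *\<^sub>v f = l \<cdot>\<^sub>v f"
    by (rule second_eigenvalue_plane[OF M n2, of "?ind S" "?ind T", folded l]) (simp, simp, blast)
  define F where "F v = (if v \<in> S then x else y)" for v
  have fF: "f = vec n (\<lambda>i. F (?v i))"
    unfolding f by (rule eq_vecI) (use mem V in \<open>auto simp: F_def\<close>)
  have fi: "f $ i = F (?v i)" if "i < n" for i using that by (simp add: fF)
  define H where "H v = a * real (card (neighbors E v)) * F v + (\<Sum>w\<in>neighbors E v. F w)" for v
  have Mf: "(M *\<^sub>v f) $ i = H (?v i)" if "i < n" for i
    using graph_matrix_mult_vec[OF G, of i a F] that by (simp add: M_def fF H_def n_def)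
  have dimM: "dim_vec (M *\<^sub>v f) = n"
    by (simp add: M_def n_def adjacency_matrix_def)
  \<comment> \<open>If all neighbours of \<open>v\<close> had value \<open>z\<close>, the sum would
    be the degree times \<open>z\<close>; each neighbour outside \<open>A\<close> corrects it by
    \<open>z - z'\<close>. Used with \<open>A = S\<close> and with \<open>A = T\<close>.\<close>
  have side: "(\<Sum>w\<in>neighbors E v. F w) = real (card (neighbors E v)) * z - real (outdeg E A v) * (z - z')"
    if "\<And>w. w \<in> A \<Longrightarrow> F w = z" "\<And>w. w \<in> V - A \<Longrightarrow> F w = z'" for A z z' v
  proof -
    let ?N = "neighbors E v"
    have N: "?N \<subseteq> V" "finite ?N" using simple_graph_neighbors[OF G] by auto
    have "(\<Sum>w\<in>?N. F w) = (\<Sum>w\<in>?N \<inter> A. F w) + (\<Sum>w\<in>?N - A. F w)"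
      by (rule sum.Int_Diff[OF N(2)])
    also have "(\<Sum>w\<in>?N \<inter> A. F w) = real (card (?N \<inter> A)) * z" using that(1) by simp
    also have "(\<Sum>w\<in>?N - A. F w) = real (card (?N - A)) * z'"
      using that(2) N by (simp add: subset_eq)
    finally have "(\<Sum>w\<in>?N. F w) = real (card (?N \<inter> A)) * z + real (card (?N - A)) * z'" .
    moreover have "real (card ?N) = real (card (?N \<inter> A)) + real (card (?N - A))"
      using N card_Int_Diff[of ?N A] by simp
    ultimately show ?thesis by (simp add: outdeg_def algebra_simps)
  qed
  have HS: "H v = (a + 1) * real (card (neighbors E v)) * x - real (outdeg E S v) * (x - y)" if "v \<in> S" for v
    using side[of S x y v] that by (simp add: H_def F_def algebra_simps)
  have HT: "H v = (a + 1) * real (card (neighbors E v)) * y - real (outdeg E T v) * (y - x)" if "v \<in> T" for v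
  proof -
    have "\<And>w. w \<in> T \<Longrightarrow> F w = y" "\<And>w. w \<in> V - T \<Longrightarrow> F w = x" by (auto simp: F_def T_def)
    from side[of T y x v, OF this] show ?thesis using that by (simp add: H_def F_def T_def algebra_simps)
  qed
  have ff: "f \<bullet> f = s * x\<^sup>2 + t * y\<^sup>2"
  proof -
    have "f \<bullet> f = (\<Sum>v\<in>V. F v * F v)"
      unfolding sum_vertex_list[OF fin(1), symmetric]
      by (simp add: fF scalar_prod_def atLeast0LessThan n_def)
    also have "\<dots> = (\<Sum>v\<in>S. F v * F v) + (\<Sum>v\<in>T. F v * F v)"
      unfolding V(1) using fin V by (intro sum.union_disjoint) auto
    also have "(\<Sum>v\<in>S. F v * F v) = s * x\<^sup>2" by (simp add: F_def s_def power2_eq_square)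
    also have "(\<Sum>v\<in>T. F v * F v) = (\<Sum>v\<in>T. y * y)" by (rule sum.cong) (auto simp: F_def T_def)
    finally show ?thesis by (simp add: t_def power2_eq_square)
  qed
  have ffpos: "f \<bullet> f > 0"
    unfolding ff using xy pos by (auto intro: add_pos_nonneg add_nonneg_pos)
  have mT: "real (\<Sum>v\<in>T. outdeg E T v) = m"
    unfolding m_def T_def by (simp only: sum_outdeg_complement[OF G S])
  have deg: "(a + 1) * real \<delta> * z\<^sup>2 \<le> (a + 1) * real (card (neighbors E v)) * z\<^sup>2" if "v \<in> V" for v z
    using \<delta>[OF that] a by (intro mult_right_mono mult_left_mono) auto
  \<comment> \<open>The two ends of a cut edge contribute \<open>x * (x - y)\<close> and
    \<open>y * (y - x)\<close>, in total \<open>(x - y)\<^sup>2\<close>. Replacing degrees by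
    \<open>\<delta>\<close> is a lower bound because \<open>a + 1\<close> is nonnegative.\<close>
  have q: "(a + 1) * real \<delta> * (f \<bullet> f) - m * (x - y)\<^sup>2 \<le> f \<bullet> (M *\<^sub>v f)"
  proof -
    have "f \<bullet> (M *\<^sub>v f) = (\<Sum>i<n. F (?v i) * H (?v i))"
      unfolding scalar_prod_def dimM by (rule sum.cong) (auto simp: Mf fi)
    also have "\<dots> = (\<Sum>v\<in>V. F v * H v)"
      unfolding n_def by (rule sum_vertex_list[OF fin(1)])
    also have "\<dots> = (\<Sum>v\<in>S. F v * H v) + (\<Sum>v\<in>T. F v * H v)"
      unfolding V(1) using fin V by (intro sum.union_disjoint) auto
    finally have qq: "f \<bullet> (M *\<^sub>v f) = (\<Sum>v\<in>S. F v * H v) + (\<Sum>v\<in>T. F v * H v)" .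
    have "(\<Sum>v\<in>S. (a + 1) * real \<delta> * x\<^sup>2 - real (outdeg E S v) * (x * (x - y))) \<le> (\<Sum>v\<in>S. F v * H v)"
    proof (rule sum_mono)
      fix v assume v: "v \<in> S"
      show "(a + 1) * real \<delta> * x\<^sup>2 - real (outdeg E S v) * (x * (x - y)) \<le> F v * H v"
      proof -
        have "v \<in> V" using v S by blast
        moreover have "F v = x" using v by (simp add: F_def)
        then have "F v * H v = (a + 1) * real (card (neighbors E v)) * x\<^sup>2
            - real (outdeg E S v) * (x * (x - y))"
          by (simp add: HS[OF v] power2_eq_square algebra_simps)
        ultimately show ?thesis using deg[of v x] by simp
      qed
    qed
    moreover have "(\<Sum>v\<in>T. (a + 1) * real \<delta> * y\<^sup>2 - real (outdeg E T v) * (y * (y - x))) \<le> (\<Sum>v\<in>T. F v * H v)"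
    proof (rule sum_mono)
      fix v assume v: "v \<in> T"
      show "(a + 1) * real \<delta> * y\<^sup>2 - real (outdeg E T v) * (y * (y - x)) \<le> F v * H v"
      proof -
        have "v \<in> V" using v by (simp add: T_def)
        moreover have "F v = y" using v by (simp add: F_def T_def)
        then have "F v * H v = (a + 1) * real (card (neighbors E v)) * y\<^sup>2
            - real (outdeg E T v) * (y * (y - x))"
          by (simp add: HT[OF v] power2_eq_square algebra_simps)
        ultimately show ?thesis using deg[of v y] by simp
      qed
    qed
    moreover have "(\<Sum>v\<in>S. (a + 1) * real \<delta> * x\<^sup>2 - real (outdeg E S v) * (x * (x - y)))
        = s * ((a + 1) * real \<delta> * x\<^sup>2) - m * (x * (x - y))"
      by (simp add: sum_subtractf s_def m_def sum_distrib_right)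
    moreover have "(\<Sum>v\<in>T. (a + 1) * real \<delta> * y\<^sup>2 - real (outdeg E T v) * (y * (y - x)))
        = t * ((a + 1) * real \<delta> * y\<^sup>2) - m * (y * (y - x))"
      unfolding mT[symmetric] by (simp add: sum_subtractf t_def sum_distrib_right)
    moreover have "(a + 1) * real \<delta> * (f \<bullet> f) - m * (x - y)\<^sup>2
        = s * ((a + 1) * real \<delta> * x\<^sup>2) - m * (x * (x - y))
          + (t * ((a + 1) * real \<delta> * y\<^sup>2) - m * (y * (y - x)))"
      unfolding ff by (simp add: power2_eq_square algebra_simps)
    ultimately show ?thesis unfolding qq by linarith
  qed
  \<comment> \<open>This is the Cauchy-Schwarz inequality for \<open>x - y\<close> with its defect
    written out as a square.\<close>
  have "(1 / s + 1 / t) * (s * x\<^sup>2 + t * y\<^sup>2) - (x - y)\<^sup>2 = (s * x + t * y)\<^sup>2 / (s * t)"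
    using pos by (simp add: field_simps power2_eq_square)
  moreover have "\<dots> \<ge> 0" using pos by simp
  ultimately have "(x - y)\<^sup>2 \<le> (1 / s + 1 / t) * (f \<bullet> f)" unfolding ff by linarith
  then have "m * (x - y)\<^sup>2 \<le> m * ((1 / s + 1 / t) * (f \<bullet> f))"
    by (rule mult_left_mono) (simp only: m_def of_nat_0_le_iff)
  moreover have \<mu>: "\<mu> * (f \<bullet> f) = (a + 1) * real \<delta> * (f \<bullet> f) - m * ((1 / s + 1 / t) * (f \<bullet> f))"
  proof -
    have "\<mu> = (a + 1) * real \<delta> - m * (1 / s + 1 / t)"
      by (simp only: \<mu>_def m_def s_def t_def T_def)
    then show ?thesis by (simp only: left_diff_distrib mult.assoc)
  qed
  ultimately have \<mu>q: "\<mu> * (f \<bullet> f) \<le> f \<bullet> (M *\<^sub>v f)" using q by linarith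
  with le have "\<mu> * (f \<bullet> f) \<le> l * (f \<bullet> f)" by linarith
  then show "\<mu> \<le> graph_eigenvalue 2 V E a" using ffpos unfolding l_def by simp
  \<comment> \<open>Now \<open>\<mu> * (f \<bullet> f) \<le> f \<bullet> (M *\<^sub>v f) \<le> l *
    (f \<bullet> f)\<close> collapses to equalities, so \<open>f\<close> is an eigenvector.\<close>
  assume "graph_eigenvalue 2 V E a = \<mu>"
  then have "f \<bullet> (M *\<^sub>v f) = l * (f \<bullet> f)" using le \<mu>q unfolding l_def by simp
  then have "M *\<^sub>v f = l \<cdot>\<^sub>v f" using eq by blast
  then have "H (?v i) = l * F (?v i)" if "i < n" for i
    using Mf[OF that] fi[OF that] that by (simp add: fF)
  then have H: "H v = l * F v" if "v \<in> V" for v using idx[OF that] by blast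
  have inS: "x0 \<in> V" "y0 \<in> V" "y0 \<in> T" "y0 \<notin> S" using x0 y0 S by (auto simp: T_def)
  have "(a + 1) * real (card (neighbors E x0)) * x = l * x"
  proof -
    have "H x0 = l * x" using H[OF inS(1)] x0 by (simp only: F_def if_True)
    moreover have "H x0 = (a + 1) * real (card (neighbors E x0)) * x" using HS[OF x0(1)] x0 by simp
    ultimately show ?thesis by metis
  qed
  moreover have "(a + 1) * real (card (neighbors E y0)) * y = l * y"
  proof -
    have "H y0 = l * y" using H[OF inS(2)] inS by (simp only: F_def if_False)
    moreover have "H y0 = (a + 1) * real (card (neighbors E y0)) * y"
      using HT[OF inS(3)] y0 by (simp add: T_def)
    ultimately show ?thesis by metis
  qed
  \<comment> \<open>One of \<open>x\<close> and \<open>y\<close> may be zero, so the eigenvalue is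
    read off at \<open>x0\<close> or at \<open>y0\<close>, on whichever side \<open>f\<close> does
    not vanish.\<close>
  ultimately have "(x \<noteq> 0 \<longrightarrow> l = (a + 1) * real (card (neighbors E x0))) \<and>
      (y \<noteq> 0 \<longrightarrow> l = (a + 1) * real (card (neighbors E y0)))" unfolding mult_cancel_right by auto
  then obtain v where "v \<in> V" "l = (a + 1) * real (card (neighbors E v))"
    using xy inS by blast
  moreover have "(a + 1) * real \<delta> \<le> (a + 1) * real (card (neighbors E v))" if "v \<in> V" for v
    using \<delta>[OF that] a by (intro mult_left_mono) auto
  ultimately show "(a + 1) * real \<delta> \<le> graph_eigenvalue 2 V E a" unfolding l_def by simp
qed

text \<open>Delete a minimum disconnecting set \<open>F\<close> and let \<open>S\<close> be the
  vertices still reachable from some \<open>u\<close> that no longer reaches all of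
  \<open>V\<close>. Every edge leaving \<open>S\<close> must belong to \<open>F\<close>.\<close>

lemma edge_connectivity_edge_cut:
  assumes G: "simple_graph V E" and "card V \<ge> 2"
  obtains S where "S \<subseteq> V" "S \<noteq> {}" "V - S \<noteq> {}" "(\<Sum>v\<in>S. outdeg E S v) \<le> edge_connectivity V E"
proof -
  have finV: "finite V" and finE: "finite E"
    using G by (auto simp: simple_graph_def intro: finite_subset[of E "Pow V"])
  let ?C = "{card F | F. F \<subseteq> E \<and> \<not> graph_connected V (E - F)}"
  have "?C \<subseteq> card ` Pow E" by auto
  then have "finite ?C" using finE by (meson finite_Pow_iff finite_imageI finite_subset)
  \<comment> \<open>Deleting all edges disconnects at least two vertices, so the minimum is over a
    nonempty set and is attained.\<close>
  moreover have "\<not> graph_connected V (E - E)"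
  proof
    assume conn: "graph_connected V (E - E)"
    obtain u v where "u \<in> V" "v \<in> V" "u \<noteq> v"
      using \<open>card V \<ge> 2\<close> card_le_Suc0_iff_eq[OF finV] by fastforce
    with conn show False by (auto simp: graph_connected_def)
  qed
  then have "?C \<noteq> {}" by blast
  ultimately have "Min ?C \<in> ?C" by (rule Min_in)
  moreover have "edge_connectivity V E = Min ?C"
    using \<open>card V \<ge> 2\<close> by (simp add: edge_connectivity_def)
  ultimately obtain F where F: "F \<subseteq> E" "\<not> graph_connected V (E - F)" "edge_connectivity V E = card F"
    by auto
  let ?R = "{(x, y). {x, y} \<in> E - F}"
  obtain u v where uv: "u \<in> V" "v \<in> V" "(u, v) \<notin> ?R\<^sup>*"
    using F(2) by (auto simp: graph_connected_def)
  define S where "S = {w \<in> V. (u, w) \<in> ?R\<^sup>*}"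
  have cut: "{x, w} \<in> F" if "x \<in> S" "w \<in> neighbors E x" "w \<notin> S" for x w
  proof (rule ccontr)
    assume "{x, w} \<notin> F"
    then have "(x, w) \<in> ?R" using that by (simp add: neighbors_def)
    then have "(u, w) \<in> ?R\<^sup>*" using that(1) unfolding S_def by (auto intro: rtrancl_into_rtrancl)
    moreover have "w \<in> V" using that(2) simple_graph_neighbors(1)[OF G] by blast
    ultimately show False using that(3) by (simp add: S_def)
  qed
  have "(\<Sum>v\<in>S. outdeg E S v) = card (SIGMA v:S. neighbors E v - S)"
    using finV simple_graph_neighbors(2)[OF G] by (intro sum_outdeg) (auto simp: S_def)
  \<comment> \<open>A pair with first component in \<open>S\<close> and second outside is determined
    by its underlying edge.\<close>
  also have "\<dots> = card ((\<lambda>(x, w). {x, w}) ` (SIGMA v:S. neighbors E v - S))"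
    by (rule card_image[symmetric]) (auto simp: inj_on_def doubleton_eq_iff)
  also have "\<dots> \<le> card F"
    using cut finite_subset[OF F(1) finE] by (intro card_mono) auto
  finally have "(\<Sum>v\<in>S. outdeg E S v) \<le> edge_connectivity V E" by (simp add: F(3))
  moreover have "S \<subseteq> V" "u \<in> S" "v \<in> V - S" using uv by (auto simp: S_def)
  ultimately show thesis using that[of S] by blast
qed

text \<open>A finite girth provides an edge, which excludes the case where
  \<open>edge_connectivity\<close> is 0 by convention.\<close>

lemma finite_girth_card_ge_2:
  assumes G: "simple_graph V E" and "girth E = enat g"
  shows "card V \<ge> 2"
proof -
  have "E \<noteq> {}"
  proof
    assume "E = {}"
    then have "\<not> is_cycle E c" for c by (auto simp: is_cycle_def intro!: exI[of _ 0])
    then have "girth E = Inf {}" unfolding girth_def by (intro arg_cong[of _ _ Inf]) auto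
    with assms(2) show False by (simp add: top_enat_def)
  qed
  then obtain e where "e \<subseteq> V" "card e = 2" "finite V" using G by (auto simp: simple_graph_def)
  then show ?thesis using card_mono by metis
qed

section \<open>Combining the size of the sides with the spectral bound\<close>

theorem theorem1p6:
  fixes V :: "'a set" and E :: "'a set set" and a :: real and g k n \<delta> :: nat
  assumes "simple_graph V E"
    and "card V = n"
    and "min_degree V E = \<delta>"
    and "girth E = enat g"
    and "g \<ge> 3" and "k \<ge> 2" and "\<delta> \<ge> k"
    and "a \<ge> -1"
  shows "(graph_eigenvalue 2 V E a \<le> (a + 1) * real \<delta>
            - (real k - 1) * real n
              / (real (n1_star \<delta> g) * (real n - real (n1_star \<delta> g)))
          \<longrightarrow> edge_connectivity V E \<ge> k)
       \<and> (graph_eigenvalue 2 V E a < (a + 1) * real \<delta>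
            - 2 * (real k - 1) / real (n1_star \<delta> g)
          \<longrightarrow> edge_connectivity V E \<ge> k)"
proof (cases "edge_connectivity V E \<ge> k")
  case False
  note G = assms(1)
  have finV: "finite V" using G by (simp add: simple_graph_def)
  have deg: "\<delta> \<le> card (neighbors E v)" if "v \<in> V" for v
    using that finV assms(3) simple_graph_neighbors(4)[OF G, of v]
    unfolding min_degree_def by (metis Min_le finite_imageI imageI)
  obtain S where S: "S \<subseteq> V" "S \<noteq> {}" "V - S \<noteq> {}" "(\<Sum>v\<in>S. outdeg E S v) \<le> edge_connectivity V E"
    using edge_connectivity_edge_cut[OF G finite_girth_card_ge_2[OF G assms(4)]] by blast
  define m where "m = (\<Sum>v\<in>S. outdeg E S v)"
  have m: "m < k" using S(4) False by (simp add: m_def)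
  have side: "small_edge_boundary E A \<delta>" if "A \<subseteq> V" "A \<noteq> {}" "(\<Sum>v\<in>A. outdeg E A v) = m" for A
    using that G m \<open>\<delta> \<ge> k\<close> deg simple_graph_neighbors(2)[OF G] finite_subset[OF that(1) finV]
    by unfold_locales (auto simp: simple_graph_def)
  interpret S: small_edge_boundary E S \<delta> by (rule side) (use S m_def in auto)
  interpret T: small_edge_boundary E "V - S" \<delta>
    by (rule side) (use S in \<open>auto simp: m_def sum_outdeg_complement[OF G]\<close>)
  define N s t where "N = real (n1_star \<delta> g)" and "s = real (card S)" and "t = real (card (V - S))"
  have N: "N \<le> s" "N \<le> t"
    using S.n1_star_le_card T.n1_star_le_card assms(4-7) by (auto simp: N_def s_def t_def)
  have "N > 0" by (simp add: N_def n1_star_def Let_def)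
  have n: "real n = s + t"
    using S(1) finV assms(2) card_mono[OF finV S(1)]
    by (simp add: s_def t_def card_Diff_subset finite_subset)
  obtain x0 y0 where "x0 \<in> S" "outdeg E S x0 = 0" "y0 \<in> V - S" "outdeg E (V - S) y0 = 0"
    using S.interior_vertex T.interior_vertex by metis
  note bound = second_eigenvalue_edge_cut[OF G S(1) deg assms(8) this, folded m_def s_def t_def]
  have "1 / s + 1 / t \<le> (s + t) / (N * (s + t - N))"
  proof -
    \<comment> \<open>The difference of the two sides is \<open>(s - N) * (t - N)\<close>: for a
      fixed order \<open>s + t\<close>, the product is smallest when one side has size
      \<open>N\<close>.\<close>
    have "N * (s + t - N) \<le> s * t"
      using mult_nonneg_nonneg[of "s - N" "t - N"] N by (simp add: algebra_simps)
    moreover have "1 / s + 1 / t = (s + t) / (s * t)" using N \<open>N > 0\<close> by (simp add: field_simps)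
    ultimately show ?thesis using N \<open>N > 0\<close> by (simp add: divide_left_mono)
  qed
  moreover have "1 / s + 1 / t \<le> 2 / N"
    using frac_le[of 1 1 N s] frac_le[of 1 1 N t] N \<open>N > 0\<close> by simp
  moreover have "real m * (1 / s + 1 / t) \<le> (real k - 1) * c" if "1 / s + 1 / t \<le> c" for c
    using that m N \<open>N > 0\<close> by (intro mult_mono) auto
  ultimately have "real m * (1 / s + 1 / t) \<le> (real k - 1) * ((s + t) / (N * (s + t - N)))"
    "real m * (1 / s + 1 / t) \<le> (real k - 1) * (2 / N)" by blast+
  then have le: "real m * (1 / s + 1 / t) \<le> (real k - 1) * real n / (N * (real n - N))"
    "real m * (1 / s + 1 / t) \<le> 2 * (real k - 1) / N"
    unfolding n by (simp_all add: mult.commute)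
  \<comment> \<open>In part (i) the hypothesis and the spectral bound together only force equality.
    The equality case then gives \<open>(a + 1) * real \<delta>\<close> as a lower bound for the
    eigenvalue, which contradicts the hypothesis because the subtracted term is positive. In part
    (ii) the strict inequality suffices.\<close>
  have pos: "(real k - 1) * real n / (N * (real n - N)) > 0"
    using N \<open>N > 0\<close> \<open>k \<ge> 2\<close> n by (intro divide_pos_pos mult_pos_pos) auto
  show ?thesis unfolding N_def[symmetric] using bound le pos by auto
qed simp

end
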